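(* Let $\mathcal{S}$ be the lexicographic sum of a class of $\mathrm{L}_\mathfrak{N}$-structures $\mathfrak{N}:=\{\mathcal{N}_a\}_{a\in\mathcal{M}}$ with respect to an $\mathrm{L}_\mathcal{M}$-structure $\mathcal{M}$. Assume: - for every sentence $\phi\in\mathrm{L}_\mathfrak{N}$, the set $\{a\in\mathcal{M}\mid\mathcal{N}_a\models\phi\}$ is $\emptyset$-definable in $\mathcal{M}$; - $\mathcal{M}$ is NIP; - for all $\rho\in S_1^{\mathrm{Th}(\mathcal{M})}$, $\mathcal{N}_\rho$ is NIP. Then $\mathcal{S}$ is NIP.
   Context: $\mathrm{L}_\mathcal{M},\mathrm{L}_\mathfrak{N}$ are disjoint languages, not necessarily relational. Lexicographic sum: $\mathcal{S}=\mathcal{M}[\mathfrak{N}]$ is the multisorted structure with a main sort $S:=\bigcup_{a\in\mathcal{M}}\{a\}\times\mathcal{N}_a$, a sort for the structure $\mathcal{M}$ (in $\mathrm{L}_\mathcal{M}$), and the projection $v:S\to\mathcal{M}$, $(a,b)\mapsto a$. The sort $S$ carries a structure in a copy $\{P_\bullet\}_{P\in\mathrm{L}_\mathfrak{N}}$ of $\mathrm{L}_\mathfrak{N}$. For an $n$-ary predicate $P$, $P_\bullet:=\{((a,b_1),\dots,(a,b_n))\mid a\in\mathcal{M},\ \mathcal{N}_a\models P(b_1,\dots,b_n)\}$. For an $n$-ary function symbol $f$, $f_\bullet((a_1,b_1),\dots,(a_n,b_n)):=(a,f^{\mathcal{N}_a}(b_1,\dots,b_n))$ if $a_1=\dots=a_n=a$,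 and $:=u$ otherwise, where $u$ is a constant standing for "undetermined". $\mathcal{N}_\rho$: $S_1^{\mathrm{Th}(\mathcal{M})}$ is the set of complete $1$-types over $\emptyset$ of $\mathrm{Th}(\mathcal{M})$; for $\rho$ in it, $\mathcal{N}_\rho$ denotes the ultraproduct $\prod_\mathcal{U}\mathcal{N}_a$ for any ultrafilter $\mathcal{U}$ on $\mathcal{M}$ containing $\{\phi(\mathcal{M})\mid\phi\in\rho\}$; by the definability assumption its theory does not depend on $\mathcal{U}$. *)

theory Defs
  imports "HOL-Library.FuncSet"
begin

section \<open>Many-sorted first-order logic with equality\<close>

text \<open>
  The sorts of a language are all elements of \<open>'s\<close>.  The symbols are restricted to the sets
  \<open>fsyms\<close> and \<open>rsyms\<close>, which may be empty (a HOL type may not), so that relational languages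
  are covered.  A one-sorted language is one with \<open>'s = unit\<close>; the arity of a symbol is then the
  length of \<open>fdom\<close> or \<open>rdom\<close>, and constants are the function symbols with \<open>fdom L f = []\<close>.
\<close>

record ('s, 'f, 'r) language =
  fsyms :: "'f set"
  fdom :: "'f \<Rightarrow> 's list"
  fcod :: "'f \<Rightarrow> 's"
  rsyms :: "'r set"
  rdom :: "'r \<Rightarrow> 's list"

record ('s, 'f, 'r, 'a) struct =
  universe :: "'s \<Rightarrow> 'a set"
  fint :: "'f \<Rightarrow> 'a list \<Rightarrow> 'a"
  rint :: "'r \<Rightarrow> 'a list \<Rightarrow> bool"

definition is_structure :: "('s, 'f, 'r) language \<Rightarrow> ('s, 'f, 'r, 'a) struct \<Rightarrow> bool" where
  "is_structure L A \<longleftrightarrow>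
     (\<forall>s. universe A s \<noteq> {}) \<and>
     (\<forall>f\<in>fsyms L. \<forall>xs. list_all2 (\<lambda>x s. x \<in> universe A s) xs (fdom L f) \<longrightarrow>
        fint A f xs \<in> universe A (fcod L f))"

type_synonym 's var = "'s \<times> nat"

datatype ('s, 'f) trm = Var "'s var" | Fn 'f "('s, 'f) trm list"

datatype ('s, 'f, 'r) form =
    Eq "('s, 'f) trm" "('s, 'f) trm"
  | Rel 'r "('s, 'f) trm list"
  | Neg "('s, 'f, 'r) form"
  | And "('s, 'f, 'r) form" "('s, 'f, 'r) form"
  | Exi "'s var" "('s, 'f, 'r) form"

fun trm_sort :: "('s, 'f, 'r) language \<Rightarrow> ('s, 'f) trm \<Rightarrow> 's" where
  "trm_sort L (Var x) = fst x"
| "trm_sort L (Fn f ts) = fcod L f"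

fun wf_trm :: "('s, 'f, 'r) language \<Rightarrow> ('s, 'f) trm \<Rightarrow> bool" where
  "wf_trm L (Var x) \<longleftrightarrow> True"
| "wf_trm L (Fn f ts) \<longleftrightarrow>
     f \<in> fsyms L \<and> map (trm_sort L) ts = fdom L f \<and> (\<forall>t\<in>set ts. wf_trm L t)"

fun wf_form :: "('s, 'f, 'r) language \<Rightarrow> ('s, 'f, 'r) form \<Rightarrow> bool" where
  "wf_form L (Eq t u) \<longleftrightarrow> wf_trm L t \<and> wf_trm L u \<and> trm_sort L t = trm_sort L u"
| "wf_form L (Rel r ts) \<longleftrightarrow>
     r \<in> rsyms L \<and> map (trm_sort L) ts = rdom L r \<and> (\<forall>t\<in>set ts. wf_trm L t)"
| "wf_form L (Neg \<phi>) \<longleftrightarrow> wf_form L \<phi>"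
| "wf_form L (And \<phi> \<psi>) \<longleftrightarrow> wf_form L \<phi> \<and> wf_form L \<psi>"
| "wf_form L (Exi x \<phi>) \<longleftrightarrow> wf_form L \<phi>"

fun trm_vars :: "('s, 'f) trm \<Rightarrow> 's var set" where
  "trm_vars (Var x) = {x}"
| "trm_vars (Fn f ts) = (\<Union>t\<in>set ts. trm_vars t)"

fun free_vars :: "('s, 'f, 'r) form \<Rightarrow> 's var set" where
  "free_vars (Eq t u) = trm_vars t \<union> trm_vars u"
| "free_vars (Rel r ts) = (\<Union>t\<in>set ts. trm_vars t)"
| "free_vars (Neg \<phi>) = free_vars \<phi>"
| "free_vars (And \<phi> \<psi>) = free_vars \<phi> \<union> free_vars \<psi>"
| "free_vars (Exi x \<phi>) = free_vars \<phi> - {x}"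

definition assignment :: "('s, 'f, 'r, 'a) struct \<Rightarrow> ('s var \<Rightarrow> 'a) \<Rightarrow> bool" where
  "assignment A e \<longleftrightarrow> (\<forall>x. e x \<in> universe A (fst x))"

fun trm_val :: "('s, 'f, 'r, 'a) struct \<Rightarrow> ('s var \<Rightarrow> 'a) \<Rightarrow> ('s, 'f) trm \<Rightarrow> 'a" where
  "trm_val A e (Var x) = e x"
| "trm_val A e (Fn f ts) = fint A f (map (trm_val A e) ts)"

fun sat :: "('s, 'f, 'r, 'a) struct \<Rightarrow> ('s var \<Rightarrow> 'a) \<Rightarrow> ('s, 'f, 'r) form \<Rightarrow> bool" where
  "sat A e (Eq t u) \<longleftrightarrow> trm_val A e t = trm_val A e u"
| "sat A e (Rel r ts) \<longleftrightarrow> rint A r (map (trm_val A e) ts)"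
| "sat A e (Neg \<phi>) \<longleftrightarrow> \<not> sat A e \<phi>"
| "sat A e (And \<phi> \<psi>) \<longleftrightarrow> sat A e \<phi> \<and> sat A e \<psi>"
| "sat A e (Exi x \<phi>) \<longleftrightarrow> (\<exists>a\<in>universe A (fst x). sat A (e(x := a)) \<phi>)"

definition is_sentence :: "('s, 'f, 'r) language \<Rightarrow> ('s, 'f, 'r) form \<Rightarrow> bool" where
  "is_sentence L \<phi> \<longleftrightarrow> wf_form L \<phi> \<and> free_vars \<phi> = {}"

definition models :: "('s, 'f, 'r, 'a) struct \<Rightarrow> ('s, 'f, 'r) form \<Rightarrow> bool" where
  "models A \<phi> \<longleftrightarrow> (\<forall>e. assignment A e \<longrightarrow> sat A e \<phi>)"

section \<open>NIP\<close>

text \<open>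
  A partitioned formula \<open>\<phi>(x;y)\<close> is a formula together with a set \<open>X\<close> of variables: \<open>x\<close>
  consists of the free variables in \<open>X\<close> and \<open>y\<close> of the others.  Tuples are given
  by assignments, and \<open>override_on (b I) (a i) X\<close> is the assignment \<open>x := a i, y := b I\<close>.
  The finitary form of the independence property only depends on the theory of the structure, so
  that it needs no passage to elementary extensions.
\<close>

definition has_IP :: "('s, 'f, 'r, 'a) struct \<Rightarrow> ('s, 'f, 'r) form \<Rightarrow> 's var set \<Rightarrow> bool" where
  "has_IP A \<phi> X \<longleftrightarrow>
     (\<forall>n::nat. \<exists>(a :: nat \<Rightarrow> 's var \<Rightarrow> 'a) (b :: nat set \<Rightarrow> 's var \<Rightarrow> 'a).
        (\<forall>i<n. assignment A (a i)) \<and>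
        (\<forall>I. I \<subseteq> {..<n} \<longrightarrow> assignment A (b I)) \<and>
        (\<forall>i<n. \<forall>I. I \<subseteq> {..<n} \<longrightarrow> (sat A (override_on (b I) (a i) X) \<phi> \<longleftrightarrow> i \<in> I)))"

definition NIP :: "('s, 'f, 'r) language \<Rightarrow> ('s, 'f, 'r, 'a) struct \<Rightarrow> bool" where
  "NIP L A \<longleftrightarrow> (\<forall>\<phi> X. wf_form L \<phi> \<longrightarrow> \<not> has_IP A \<phi> X)"

section \<open>Definable sets and complete 1-types of one-sorted structures\<close>

definition unary_forms :: "(unit, 'f, 'r) language \<Rightarrow> (unit, 'f, 'r) form set" where
  "unary_forms L = {\<phi>. wf_form L \<phi> \<and> free_vars \<phi> \<subseteq> {((), 0)}}"

text \<open>
  \<open>solutions A \<phi>\<close> is \<open>\<phi>(A)\<close> for \<open>\<phi>\<close> in \<open>unary_forms\<close>; only the value of the variable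
  \<open>((), 0)\<close> matters.
\<close>

definition solutions :: "(unit, 'f, 'r, 'a) struct \<Rightarrow> (unit, 'f, 'r) form \<Rightarrow> 'a set" where
  "solutions A \<phi> = {a \<in> universe A (). sat A (\<lambda>_. a) \<phi>}"

definition zero_definable ::
  "(unit, 'f, 'r) language \<Rightarrow> (unit, 'f, 'r, 'a) struct \<Rightarrow> 'a set \<Rightarrow> bool" where
  "zero_definable L A D \<longleftrightarrow> (\<exists>\<phi>\<in>unary_forms L. D = solutions A \<phi>)"

text \<open>
  The complete 1-types over the empty set of the theory of \<open>A\<close>.  As that theory is complete, a set
  of formulas in one variable is consistent with it iff it is finitely satisfiable in \<open>A\<close>.
\<close>

definition complete_1_types ::
  "(unit, 'f, 'r) language \<Rightarrow> (unit, 'f, 'r, 'a) struct \<Rightarrow> (unit, 'f, 'r) form set set" where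
  "complete_1_types L A =
     {\<rho>. \<rho> \<subseteq> unary_forms L \<and>
         (\<forall>\<Phi>. finite \<Phi> \<and> \<Phi> \<subseteq> \<rho> \<longrightarrow> (\<exists>a\<in>universe A (). \<forall>\<phi>\<in>\<Phi>. a \<in> solutions A \<phi>)) \<and>
         (\<forall>\<phi>\<in>unary_forms L. \<phi> \<in> \<rho> \<or> Neg \<phi> \<in> \<rho>)}"

section \<open>Ultraproducts of one-sorted structures\<close>

text \<open>
  An ultrafilter on a set \<open>J\<close>, as a filter on the ambient type that concentrates on \<open>J\<close>; a set
  \<open>X\<close> belongs to it iff \<open>eventually (\<lambda>a. a \<in> X) F\<close>.
\<close>

definition ultrafilter_on :: "'i set \<Rightarrow> 'i filter \<Rightarrow> bool" where
  "ultrafilter_on J F \<longleftrightarrow>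
     F \<noteq> bot \<and> F \<le> principal J \<and> (\<forall>P. eventually P F \<or> eventually (\<lambda>a. \<not> P a) F)"

definition ultra_rel ::
  "'i set \<Rightarrow> 'i filter \<Rightarrow> ('i \<Rightarrow> (unit, 'f, 'r, 'a) struct) \<Rightarrow> (('i \<Rightarrow> 'a) \<times> ('i \<Rightarrow> 'a)) set" where
  "ultra_rel J F N =
     {(g, h). g \<in> (\<Pi>\<^sub>E a\<in>J. universe (N a) ()) \<and> h \<in> (\<Pi>\<^sub>E a\<in>J. universe (N a) ()) \<and>
              eventually (\<lambda>a. g a = h a) F}"

definition ultraproduct ::
  "'i set \<Rightarrow> 'i filter \<Rightarrow> ('i \<Rightarrow> (unit, 'f, 'r, 'a) struct) \<Rightarrow>
   (unit, 'f, 'r, ('i \<Rightarrow> 'a) set) struct" where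
  "ultraproduct J F N =
     \<lparr>universe = (\<lambda>_. (\<Pi>\<^sub>E a\<in>J. universe (N a) ()) // ultra_rel J F N),
      fint = (\<lambda>f Cs. ultra_rel J F N `` {\<lambda>a\<in>J. fint (N a) f (map (\<lambda>C. (SOME g. g \<in> C) a) Cs)}),
      rint = (\<lambda>r Cs. eventually (\<lambda>a. rint (N a) r (map (\<lambda>C. (SOME g. g \<in> C) a) Cs)) F)\<rparr>"

section \<open>Lexicographic sums\<close>

text \<open>
  \<open>Main\<close> is the main sort, the union of the \<open>{a} \<times> N a\<close>, and \<open>Index\<close> the sort of \<open>M\<close>.  The
  functions \<open>f\<^sub>\<bullet>\<close> take tuples of points either to a point or to the extra value \<open>u\<close>, which is not a
  point; their values are therefore put in an auxiliary sort \<open>Extended\<close>, interpreted as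
  \<open>Main\<close> together with \<open>u\<close>, and the language has the constant \<open>u\<close> and the inclusion of \<open>Main\<close>
  in \<open>Extended\<close>.  Thus no convention for \<open>v(u)\<close> or \<open>f\<^sub>\<bullet>(\<dots>, u, \<dots>)\<close> is needed.

  For a constant \<open>c\<close> of the language of the fibres the condition \<open>a\<^sub>1 = \<dots> = a\<^sub>n = a\<close> does not
  determine \<open>a\<close>.  Here \<open>c\<^sub>\<bullet>\<close> is the function on the sort \<open>Index\<close> taking \<open>a\<close> to the value
  of \<open>c\<close> in the fibre over \<open>a\<close>.
\<close>

datatype lex_sort = Main | Index | Extended

datatype ('f, 'g) lex_fun = Proj | Incl | Undet | IndexFun 'f | FibreFun 'g

datatype ('r, 'q) lex_rel = IndexRel 'r | FibreRel 'q

datatype ('a, 'b) lex_elem = Pt "'a \<times> 'b" | Ix 'a | Undetermined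

definition lex_language ::
  "(unit, 'f, 'r) language \<Rightarrow> (unit, 'g, 'q) language \<Rightarrow>
   (lex_sort, ('f, 'g) lex_fun, ('r, 'q) lex_rel) language" where
  "lex_language LM LN =
     \<lparr>fsyms = {Proj, Incl, Undet} \<union> IndexFun ` fsyms LM \<union> FibreFun ` fsyms LN,
      fdom = (\<lambda>h. case h of
           Proj \<Rightarrow> [Main]
         | Incl \<Rightarrow> [Main]
         | Undet \<Rightarrow> []
         | IndexFun f \<Rightarrow> map (\<lambda>_. Index) (fdom LM f)
         | FibreFun f \<Rightarrow> (if fdom LN f = [] then [Index] else map (\<lambda>_. Main) (fdom LN f))),
      fcod = (\<lambda>h. case h of
           Proj \<Rightarrow> Index
         | Incl \<Rightarrow> Extended
         | Undet \<Rightarrow> Extended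
         | IndexFun f \<Rightarrow> Index
         | FibreFun f \<Rightarrow> Extended),
      rsyms = IndexRel ` rsyms LM \<union> FibreRel ` rsyms LN,
      rdom = (\<lambda>q. case q of
           IndexRel r \<Rightarrow> map (\<lambda>_. Index) (rdom LM r)
         | FibreRel r \<Rightarrow> map (\<lambda>_. Main) (rdom LN r))\<rparr>"

fun the_index :: "('a, 'b) lex_elem \<Rightarrow> 'a" where
  "the_index (Ix a) = a"

fun the_point :: "('a, 'b) lex_elem \<Rightarrow> 'a \<times> 'b" where
  "the_point (Pt p) = p"

definition lex_points ::
  "(unit, 'f, 'r, 'a) struct \<Rightarrow> ('a \<Rightarrow> (unit, 'g, 'q, 'b) struct) \<Rightarrow> ('a \<times> 'b) set" where
  "lex_points M N = (SIGMA a : universe M (). universe (N a) ())"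

definition fibre_fun ::
  "('a \<Rightarrow> (unit, 'g, 'q, 'b) struct) \<Rightarrow> 'g \<Rightarrow> ('a \<times> 'b) list \<Rightarrow> ('a, 'b) lex_elem" where
  "fibre_fun N f ps =
     (if \<forall>p\<in>set ps. fst p = fst (hd ps)
      then Pt (fst (hd ps), fint (N (fst (hd ps))) f (map snd ps))
      else Undetermined)"

definition fibre_rel ::
  "(unit, 'f, 'r, 'a) struct \<Rightarrow> ('a \<Rightarrow> (unit, 'g, 'q, 'b) struct) \<Rightarrow> 'q \<Rightarrow> ('a \<times> 'b) list \<Rightarrow> bool"
where
  "fibre_rel M N r ps \<longleftrightarrow>
     (\<exists>a\<in>universe M (). \<exists>bs. ps = map (\<lambda>b. (a, b)) bs \<and> rint (N a) r bs)"

definition lex_sum ::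
  "(unit, 'f, 'r, 'a) struct \<Rightarrow> ('a \<Rightarrow> (unit, 'g, 'q, 'b) struct) \<Rightarrow>
   (lex_sort, ('f, 'g) lex_fun, ('r, 'q) lex_rel, ('a, 'b) lex_elem) struct" where
  "lex_sum M N =
     \<lparr>universe = (\<lambda>s. case s of
           Main \<Rightarrow> Pt ` lex_points M N
         | Index \<Rightarrow> Ix ` universe M ()
         | Extended \<Rightarrow> insert Undetermined (Pt ` lex_points M N)),
      fint = (\<lambda>h xs. case h of
           Proj \<Rightarrow> Ix (fst (the_point (hd xs)))
         | Incl \<Rightarrow> hd xs
         | Undet \<Rightarrow> Undetermined
         | IndexFun f \<Rightarrow> Ix (fint M f (map the_index xs))
         | FibreFun f \<Rightarrow>
             (case xs of
                [Ix a] \<Rightarrow> Pt (a, fint (N a) f [])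
              | _ \<Rightarrow> fibre_fun N f (map the_point xs))),
      rint = (\<lambda>q xs. case q of
           IndexRel r \<Rightarrow> rint M r (map the_index xs)
         | FibreRel r \<Rightarrow> fibre_rel M N r (map the_point xs))\<rparr>"

end

theory Submission
  imports Defs "HOL-Library.Nat_Bijection"
begin

text \<open>
  An assignment in the sum is coded by a sequence of indices, each with an optional element of the
  fibre over it.  By induction on formulas, the truth of a formula in the sum is determined by the
  truth of finitely many formulas of \<open>M\<close> at the indices and of finitely many formulas of the fibres
  at tuples lying in one fibre.  By the Sauer--Shelah lemma, if a formula of the sum has the
  independence property, then so does one of these.  For a formula of \<open>M\<close> this is excluded by
  hypothesis.  A formula of the fibres would have independent patterns of every size \<open>n\<close> in some
  fibre; the existence of such a pattern is a sentence, so that the indices of these fibres form a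
  decreasing sequence of nonempty definable sets.  These lie in a common complete 1-type \<open>\<rho>\<close>, and
  then \<open>N\<^sub>\<rho>\<close> has the independence property by the theorem of Los.
\<close>

section \<open>Shattering\<close>

text \<open>NIP of each single fibre would not be enough: a pattern of size \<open>n\<close> in the
  sum may come from a different fibre for each \<open>n\<close>. One bound for all fibres is needed,
  and the structures \<open>N\<^sub>\<rho>\<close> supply it, because fibres with ever larger
  patterns accumulate at some type \<rho>. The reduction never computes an equivalent formula. It
  only records that truth depends on finitely many predicates, and counting traces asks for no more:
  if each of these predicates has polynomially many traces, so has whatever they determine. Atomic
  formulas stay tractable because no symbol takes arguments of sort \<open>Extended\<close>. A value
  of \<open>f\<^sub>\<bullet>\<close> cannot be fed into another symbol, so terms of the fibre
  language never nest.\<close>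

definition shatters :: "'i set set \<Rightarrow> 'i set \<Rightarrow> bool" where
  "shatters F J \<longleftrightarrow> (\<forall>I\<subseteq>J. \<exists>Z\<in>F. Z \<inter> J = I)"

text \<open>Pajor's form of the Sauer--Shelah lemma, by splitting at \<open>x\<close>. Sets
  shattered by \<open>F0\<close> or by \<open>F1\<close> are shattered by \<open>F\<close>. A set
  \<open>J\<close> shattered by both is counted twice, and the second count is paid for by
  \<open>insert x J\<close>, which \<open>F\<close> shatters as well.\<close>

lemma card_le_card_shattered:
  assumes "finite X" "F \<subseteq> Pow X"
  shows "card F \<le> card {J. J \<subseteq> X \<and> shatters F J}"
  using assms
proof (induction X arbitrary: F rule: finite_induct)
  case empty
  then have "F = {} \<or> F = {{}}" by auto
  then show ?case
  proof
    assume "F = {{}}"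
    then have "{J. J \<subseteq> {} \<and> shatters F J} = {{}}" by (auto simp: shatters_def)
    then show ?thesis using \<open>F = {{}}\<close> by simp
  qed simp
next
  case (insert x X)
  define F0 where "F0 = {Z \<in> F. x \<notin> Z}"
  define F1 where "F1 = (\<lambda>Z. Z - {x}) ` {Z \<in> F. x \<in> Z}"
  define S where "S = (\<lambda>F. {J. J \<subseteq> X \<and> shatters F J})"
  have finF: "finite F" using insert.hyps insert.prems finite_subset by (metis finite.insertI finite_Pow_iff)
  have finS: "finite (S G)" for G
    unfolding S_def by (rule finite_subset[of _ "Pow X"]) (use insert.hyps in auto)
  have "F = F0 \<union> {Z \<in> F. x \<in> Z}" "F0 \<inter> {Z \<in> F. x \<in> Z} = {}" by (auto simp: F0_def)
  then have "card F = card F0 + card {Z \<in> F. x \<in> Z}"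
    using finF by (metis (no_types, lifting) card_Un_disjoint finite_Un)
  also have "card {Z \<in> F. x \<in> Z} = card F1"
    unfolding F1_def by (subst card_image) (auto simp: inj_on_def)
  also have "card F0 \<le> card (S F0)" "card F1 \<le> card (S F1)"
    using insert.prems unfolding S_def by (auto intro!: insert.IH simp: F0_def F1_def)
  then have "card F0 + card F1 \<le> card (S F0) + card (S F1)" by simp
  also have "\<dots> = card (S F0 \<union> S F1) + card (S F0 \<inter> S F1)"
    by (rule card_Un_Int) (auto intro: finS)
  also have "card (S F0 \<inter> S F1) = card (insert x ` (S F0 \<inter> S F1))"
    by (subst card_image) (use insert.hyps in \<open>auto simp: inj_on_def S_def\<close>)
  also have "card (S F0 \<union> S F1) + \<dots> = card ((S F0 \<union> S F1) \<union> insert x ` (S F0 \<inter> S F1))"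
    by (rule card_Un_disjoint[symmetric]) (use insert.hyps finS in \<open>auto simp: S_def\<close>)
  also have "\<dots> \<le> card {J. J \<subseteq> insert x X \<and> shatters F J}"
  proof (rule card_mono)
    show "finite {J. J \<subseteq> insert x X \<and> shatters F J}"
      by (rule finite_subset[of _ "Pow (insert x X)"]) (use insert.hyps in auto)
    have 0: "shatters F J" if "shatters F0 J" for J
      using that unfolding shatters_def F0_def by blast
    have 1: "shatters F J" if J: "J \<subseteq> X" "shatters F1 J" for J
      unfolding shatters_def
    proof (intro allI impI)
      fix I assume "I \<subseteq> J"
      then obtain Z' where "Z' \<in> F1" "Z' \<inter> J = I"
        using J unfolding shatters_def by blast
      then obtain Z where "Z \<in> F" "x \<in> Z" "(Z - {x}) \<inter> J = I"
        unfolding F1_def by blast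
      then show "\<exists>Z\<in>F. Z \<inter> J = I" using J insert.hyps by (intro bexI[of _ Z]) auto
    qed
    have 2: "shatters F (insert x J)" if J: "J \<subseteq> X" "shatters F0 J" "shatters F1 J" for J
      unfolding shatters_def
    proof (intro allI impI)
      fix I assume I: "I \<subseteq> insert x J"
      show "\<exists>Z\<in>F. Z \<inter> insert x J = I"
      proof (cases "x \<in> I")
        case True
        have "I - {x} \<subseteq> J" using I by auto
        then obtain Z' where "Z' \<in> F1" "Z' \<inter> J = I - {x}"
          using J unfolding shatters_def by blast
        then obtain Z where "Z \<in> F" "x \<in> Z" "(Z - {x}) \<inter> J = I - {x}"
          unfolding F1_def by blast
        then show ?thesis using True J insert.hyps by (intro bexI[of _ Z]) auto
      next
        case False
        then have "I \<subseteq> J" using I by auto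
        then obtain Z where "Z \<in> F" "x \<notin> Z" "Z \<inter> J = I"
          using J unfolding shatters_def F0_def by blast
        then show ?thesis by (intro bexI[of _ Z]) auto
      qed
    qed
    show "S F0 \<union> S F1 \<union> insert x ` (S F0 \<inter> S F1) \<subseteq> {J. J \<subseteq> insert x X \<and> shatters F J}"
      using 0 1 2 unfolding S_def by blast
  qed
  finally show ?case by simp
qed

lemma card_small_subsets_le: "card {J. J \<subseteq> {..<n} \<and> card J < d} \<le> (n + 1) ^ d"
proof -
  let ?f = "\<lambda>g. g ` {..<d} - {n}"
  have "{J. J \<subseteq> {..<n} \<and> card J < d} \<subseteq> ?f ` ({..<d} \<rightarrow>\<^sub>E {..n})"
  proof
    fix J assume "J \<in> {J. J \<subseteq> {..<n} \<and> card J < d}"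
    then have J: "J \<subseteq> {..<n}" "card J < d" by auto
    have "finite J" using J(1) finite_subset by blast
    then obtain h where h: "bij_betw h {..<card J} J"
      using ex_bij_betw_nat_finite atLeast0LessThan by metis
    define g where "g = (\<lambda>i\<in>{..<d}. if i < card J then h i else n)"
    have "g \<in> {..<d} \<rightarrow>\<^sub>E {..n}"
      using h J(1) less_imp_le by (fastforce simp: g_def bij_betw_def)
    moreover have "?f g = J"
    proof -
      have "{..<d} \<inter> {i. i < card J} = {..<card J}" "h ` {..<card J} = J"
        using h J(2) by (auto simp: bij_betw_def)
      then show ?thesis using J(1) by (auto simp: g_def)
    qed
    ultimately show "J \<in> ?f ` ({..<d} \<rightarrow>\<^sub>E {..n})" by blast
  qed
  then have "card {J. J \<subseteq> {..<n} \<and> card J < d} \<le> card ({..<d} \<rightarrow>\<^sub>E {..n})"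
    by (rule surj_card_le[rotated]) (simp add: finite_PiE)
  then show ?thesis by (simp add: card_PiE)
qed

section \<open>Independent patterns and the counting of traces\<close>

text \<open>Stated for an arbitrary relation, so that it serves alike for assignments of the sum,
  for their codes, for \<open>M\<close> and for the fibres. It says that \<open>{..<n}\<close> is
  shattered by the traces of the elements of \<open>B\<close>.\<close>

definition independent :: "'x set \<Rightarrow> 'y set \<Rightarrow> ('x \<Rightarrow> 'y \<Rightarrow> bool) \<Rightarrow> nat \<Rightarrow> bool" where
  "independent A B R n \<longleftrightarrow>
     (\<exists>a. (\<forall>i<n. a i \<in> A) \<and> (\<forall>I\<subseteq>{..<n}. \<exists>b\<in>B. \<forall>i<n. R (a i) b \<longleftrightarrow> i \<in> I))"

lemma independent_mono:
  assumes "independent A B R n" "m \<le> n"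
  shows "independent A B R m"
proof -
  obtain a where "\<forall>i<n. a i \<in> A" "\<forall>I\<subseteq>{..<n}. \<exists>b\<in>B. \<forall>i<n. R (a i) b \<longleftrightarrow> i \<in> I"
    using assms unfolding independent_def by blast
  moreover from this have "\<exists>b\<in>B. \<forall>i<m. R (a i) b \<longleftrightarrow> i \<in> I" if "I \<subseteq> {..<m}" for I
    using that assms(2) by (meson lessThan_subset_iff order_less_le_trans subset_trans)
  ultimately show ?thesis
    using assms(2) unfolding independent_def by (intro exI[of _ a]) auto
qed

text \<open>A set of positions shattered by the traces becomes an independent pattern once it is
  enumerated, so it has fewer than \<open>d\<close> elements, and Pajor's bound applies.\<close>

lemma card_traces_le:
  assumes "\<not> independent A B R d" and a: "\<And>i. i < n \<Longrightarrow> a i \<in> A"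
  shows "card ((\<lambda>b. {i. i < n \<and> R (a i) b}) ` B) \<le> (n + 1) ^ d" (is "card ?F \<le> _")
proof -
  have "card ?F \<le> card {J. J \<subseteq> {..<n} \<and> shatters ?F J}"
    by (rule card_le_card_shattered) auto
  also have "\<dots> \<le> card {J. J \<subseteq> {..<n} \<and> card J < d}"
  proof (rule card_mono)
    show "finite {J. J \<subseteq> {..<n} \<and> card J < d}"
      by (rule finite_subset[of _ "Pow {..<n}"]) auto
    show "{J. J \<subseteq> {..<n} \<and> shatters ?F J} \<subseteq> {J. J \<subseteq> {..<n} \<and> card J < d}"
    proof safe
      fix J assume J: "J \<subseteq> {..<n}" "shatters ?F J"
      have "finite J" using J(1) finite_subset by blast
      then obtain h where h: "bij_betw h {..<card J} J"
        using ex_bij_betw_nat_finite atLeast0LessThan by metis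
      then have hJ: "h i \<in> J" if "i < card J" for i
        using that by (auto simp: bij_betw_def)
      have "independent A B R (card J)"
        unfolding independent_def
      proof (intro exI[of _ "a \<circ> h"] conjI allI impI)
        fix i assume "i < card J"
        then show "(a \<circ> h) i \<in> A" using hJ J(1) a by auto
      next
        fix I assume I: "I \<subseteq> {..<card J}"
        then have "h ` I \<subseteq> J" using hJ by auto
        then obtain b where b: "b \<in> B" "{i. i < n \<and> R (a i) b} \<inter> J = h ` I"
          using J(2) unfolding shatters_def by blast
        have "R ((a \<circ> h) i) b \<longleftrightarrow> i \<in> I" if i: "i < card J" for i
        proof -
          have "R ((a \<circ> h) i) b \<longleftrightarrow> h i \<in> h ` I"
            using b(2) hJ[OF i] J(1) by auto
          also have "\<dots> \<longleftrightarrow> i \<in> I"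
            using h I i by (auto simp: bij_betw_def inj_on_def)
          finally show ?thesis .
        qed
        then show "\<exists>b\<in>B. \<forall>i<card J. R ((a \<circ> h) i) b \<longleftrightarrow> i \<in> I" using b(1) by blast
      qed
      then show "card J < d" using assms(1) independent_mono not_le by blast
    qed
  qed
  also have "\<dots> \<le> (n + 1) ^ d" by (rule card_small_subsets_le)
  finally show ?thesis .
qed

text \<open>Taking \<open>n + 1\<close> to be a power \<open>2 ^ j\<close> turns the claim into
  \<open>j * k < 2 ^ j - 1\<close>. The choice \<open>j = 3 * (k + 1)\<close> is large enough,
  because \<open>2 ^ (k + 1)\<close> is at least \<open>k + 2\<close>, whose cube dominates the
  quadratic \<open>j * k + 1\<close>.\<close>

lemma ex_power_less_exp: "\<exists>n::nat. (n + 1) ^ k < 2 ^ n"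
proof -
  define j where "j = 3 * (k + 1)"
  have "j * k + 1 < (k + 2) ^ 3"
    by (simp add: j_def power3_eq_cube algebra_simps)
  also have "k + 2 \<le> 2 ^ (k + 1)"
    using less_exp[of "k + 1"] by linarith
  then have "(k + 2) ^ 3 \<le> (2 ^ (k + 1)) ^ 3"
    by (rule power_mono) simp
  also have "\<dots> = 2 ^ j"
    unfolding j_def by (metis power_mult mult.commute)
  finally have "j * k < 2 ^ j - 1"
    by linarith
  then have "(2::nat) ^ (j * k) < 2 ^ (2 ^ j - 1)"
    by simp
  then show ?thesis
    by (intro exI[of _ "2 ^ j - 1"]) (simp add: power_mult)
qed

text \<open>The abstract form of the closure of NIP under Boolean combinations. If every
  \<open>S\<close> in \<open>\<R>\<close> had a bound \<open>d S\<close>, the trace of a parameter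
  under \<open>R\<close> would be determined by the tuple of its traces under the \<open>S\<close>.
  There are at most \<open>(n + 1) ^ D\<close> such tuples, while independence of \<open>R\<close>
  demands \<open>2 ^ n\<close>.\<close>

lemma determined_independent:
  fixes A :: "'x set" and B :: "'y set"
  assumes "finite \<R>"
    and det: "\<And>x x' y y'. x \<in> A \<Longrightarrow> x' \<in> A \<Longrightarrow> y \<in> B \<Longrightarrow> y' \<in> B \<Longrightarrow>
      (\<And>S. S \<in> \<R> \<Longrightarrow> S x y \<longleftrightarrow> S x' y') \<Longrightarrow> R x y \<longleftrightarrow> R x' y'"
    and ind: "\<And>n. independent A B R n"
  shows "\<exists>S\<in>\<R>. \<forall>n. independent A B S n"
proof (rule ccontr)
  assume "\<not> ?thesis"
  then obtain d where d: "\<And>S. S \<in> \<R> \<Longrightarrow> \<not> independent A B S (d S)" by metis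
  define D where "D = (\<Sum>S\<in>\<R>. d S)"
  obtain n :: nat where n: "(n + 1) ^ D < 2 ^ n" using ex_power_less_exp by blast
  obtain a where a: "\<And>i. i < n \<Longrightarrow> a i \<in> A"
    and sh: "\<And>I. I \<subseteq> {..<n} \<Longrightarrow> \<exists>b\<in>B. \<forall>i<n. R (a i) b \<longleftrightarrow> i \<in> I"
    using ind[of n] unfolding independent_def by blast
  define tr where "tr = (\<lambda>S (b :: 'y). {i. i < n \<and> S (a i) b})"
  obtain c where c: "\<And>I. I \<subseteq> {..<n} \<Longrightarrow> c I \<in> B"
    "\<And>I i. I \<subseteq> {..<n} \<Longrightarrow> i < n \<Longrightarrow> R (a i) (c I) \<longleftrightarrow> i \<in> I"
    using sh by metis
  define \<Phi> where "\<Phi> = (\<lambda>I. \<lambda>S\<in>\<R>. tr S (c I))"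
  have "inj_on \<Phi> (Pow {..<n})"
  proof (rule inj_onI)
    fix I I' assume I: "I \<in> Pow {..<n}" "I' \<in> Pow {..<n}" and eq: "\<Phi> I = \<Phi> I'"
    have "i \<in> I \<longleftrightarrow> i \<in> I'" if i: "i < n" for i
    proof -
      have "S (a i) (c I) \<longleftrightarrow> S (a i) (c I')" if "S \<in> \<R>" for S
      proof -
        have "tr S (c I) = tr S (c I')" using fun_cong[OF eq, of S] that by (simp add: \<Phi>_def)
        then show ?thesis using i by (auto simp: tr_def)
      qed
      then have "R (a i) (c I) \<longleftrightarrow> R (a i) (c I')"
        using I i a c(1) by (intro det) auto
      then show ?thesis using c(2) I i by auto
    qed
    then show "I = I'" using I by auto
  qed
  then have "card (Pow {..<n}) = card (\<Phi> ` Pow {..<n})" by (simp add: card_image)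
  also have "\<dots> \<le> card (\<Pi>\<^sub>E S\<in>\<R>. tr S ` B)"
  proof (rule card_mono)
    have "finite (tr S ` B)" for S
      by (rule finite_subset[of _ "Pow {..<n}"]) (auto simp: tr_def)
    then show "finite (\<Pi>\<^sub>E S\<in>\<R>. tr S ` B)" using assms(1) by (intro finite_PiE) auto
    show "\<Phi> ` Pow {..<n} \<subseteq> (\<Pi>\<^sub>E S\<in>\<R>. tr S ` B)" using c(1) by (auto simp: \<Phi>_def)
  qed
  also have "\<dots> = (\<Prod>S\<in>\<R>. card (tr S ` B))" using assms(1) by (rule card_PiE)
  also have "\<dots> \<le> (\<Prod>S\<in>\<R>. (n + 1) ^ d S)"
    using card_traces_le[OF d a] unfolding tr_def by (intro prod_mono) auto
  also have "\<dots> = (n + 1) ^ D" by (simp add: D_def power_sum)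
  finally show False using n by (simp add: card_Pow)
qed

lemma independent_map:
  assumes "independent A B R n"
    and "\<And>a. a \<in> A \<Longrightarrow> f a \<in> A'" "\<And>b. b \<in> B \<Longrightarrow> g b \<in> B'"
    and "\<And>a b. a \<in> A \<Longrightarrow> b \<in> B \<Longrightarrow> R a b \<longleftrightarrow> R' (f a) (g b)"
  shows "independent A' B' R' n"
proof -
  obtain a where a: "\<forall>i<n. a i \<in> A" "\<forall>I\<subseteq>{..<n}. \<exists>b\<in>B. \<forall>i<n. R (a i) b \<longleftrightarrow> i \<in> I"
    using assms(1) unfolding independent_def by blast
  have "\<exists>b\<in>B'. \<forall>i<n. R' (f (a i)) b \<longleftrightarrow> i \<in> I" if I: "I \<subseteq> {..<n}" for I
  proof -
    obtain b where "b \<in> B" "\<forall>i<n. R (a i) b \<longleftrightarrow> i \<in> I" using a(2) I by blast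
    then show ?thesis using a(1) assms(3,4) by (intro bexI[of _ "g b"]) auto
  qed
  then show ?thesis
    using a(1) assms(2) unfolding independent_def by (intro exI[of _ "\<lambda>i. f (a i)"]) auto
qed

section \<open>Formulas\<close>

lemma trm_val_cong:
  "(\<And>x. x \<in> trm_vars t \<Longrightarrow> e x = e' x) \<Longrightarrow> trm_val A e t = trm_val A e' t"
proof (induction t)
  case (Fn f ts)
  then have "map (trm_val A e) ts = map (trm_val A e') ts" by (intro map_cong) auto
  then show ?case by (simp del: map_eq_conv)
qed simp

lemma sat_cong:
  "(\<And>x. x \<in> free_vars \<phi> \<Longrightarrow> e x = e' x) \<Longrightarrow> sat A e \<phi> \<longleftrightarrow> sat A e' \<phi>"
proof (induction \<phi> arbitrary: e e')
  case (Eq t u)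
  have "trm_val A e t = trm_val A e' t" "trm_val A e u = trm_val A e' u"
    by (rule trm_val_cong; use Eq in simp)+
  then show ?case by simp
next
  case (Rel r ts)
  have "map (trm_val A e) ts = map (trm_val A e') ts"
    using Rel by (intro map_cong[OF refl] trm_val_cong) auto
  then show ?case by (simp del: map_eq_conv)
next
  case (Neg \<phi>)
  show ?case using Neg.IH[of e e'] Neg.prems by simp
next
  case (And \<phi> \<psi>)
  show ?case using And.IH(1)[of e e'] And.IH(2)[of e e'] And.prems by simp
next
  case (Exi x \<phi>)
  have "sat A (e(x := a)) \<phi> \<longleftrightarrow> sat A (e'(x := a)) \<phi>" for a
    by (rule Exi.IH) (use Exi.prems in auto)
  then show ?case by simp
qed

lemma finite_trm_vars: "finite (trm_vars t)"
  by (induction t) auto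

lemma finite_free_vars: "finite (free_vars \<phi>)"
  by (induction \<phi>) (auto simp: finite_trm_vars)

lemma assignment_upd: "assignment A e \<Longrightarrow> a \<in> universe A (fst x) \<Longrightarrow> assignment A (e(x := a))"
  by (auto simp: assignment_def)

lemma assignment_override_on:
  "assignment A e \<Longrightarrow> assignment A e' \<Longrightarrow> assignment A (override_on e e' X)"
  by (auto simp: assignment_def override_on_def)

lemma ex_assignment:
  assumes "is_structure L A"
  shows "\<exists>e. assignment A e"
proof -
  have "\<forall>x :: 'a var. \<exists>y. y \<in> universe A (fst x)" using assms by (auto simp: is_structure_def)
  then show ?thesis unfolding assignment_def by (rule choice)
qed

lemma trm_val_in_universe:
  assumes "is_structure L A" "assignment A e" "wf_trm L t"
  shows "trm_val A e t \<in> universe A (trm_sort L t)"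
  using assms(3)
proof (induction t)
  case (Var x)
  show ?case using assms(2) by (cases x) (simp add: assignment_def)
next
  case (Fn f ts)
  have "list_all2 (\<lambda>x s. x \<in> universe A s) (map (trm_val A e) ts) (map (trm_sort L) ts)"
    unfolding list_all2_map1 list_all2_map2 using Fn by (intro list.rel_refl_strong) simp
  then show ?case using Fn.prems assms(1) by (simp add: is_structure_def)
qed

lemma models_iff_sat:
  assumes "is_sentence L \<phi>" "assignment A e"
  shows "models A \<phi> \<longleftrightarrow> sat A e \<phi>"
  using assms sat_cong[of \<phi>] unfolding models_def is_sentence_def by (metis empty_iff)

section \<open>Renaming of variables\<close>

fun rename_trm :: "('s var \<Rightarrow> 's var) \<Rightarrow> ('s, 'f) trm \<Rightarrow> ('s, 'f) trm" where
  "rename_trm \<pi> (Var x) = Var (\<pi> x)"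
| "rename_trm \<pi> (Fn f ts) = Fn f (map (rename_trm \<pi>) ts)"

fun rename :: "('s var \<Rightarrow> 's var) \<Rightarrow> ('s, 'f, 'r) form \<Rightarrow> ('s, 'f, 'r) form" where
  "rename \<pi> (Eq t u) = Eq (rename_trm \<pi> t) (rename_trm \<pi> u)"
| "rename \<pi> (Rel r ts) = Rel r (map (rename_trm \<pi>) ts)"
| "rename \<pi> (Neg \<phi>) = Neg (rename \<pi> \<phi>)"
| "rename \<pi> (And \<phi> \<psi>) = And (rename \<pi> \<phi>) (rename \<pi> \<psi>)"
| "rename \<pi> (Exi x \<phi>) = Exi (\<pi> x) (rename \<pi> \<phi>)"

lemma trm_val_rename: "trm_val A e (rename_trm \<pi> t) = trm_val A (e \<circ> \<pi>) t"
proof (induction t)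
  case (Fn f ts)
  have "map (\<lambda>t. trm_val A e (rename_trm \<pi> t)) ts = map (trm_val A (e \<circ> \<pi>)) ts"
    by (rule map_cong[OF refl Fn])
  then show ?case by (simp add: comp_def del: map_eq_conv)
qed simp

text \<open>Bound variables are renamed too, so that injectivity of \<open>\<pi>\<close> excludes capture.\<close>

lemma sat_rename:
  assumes "inj \<pi>" "\<And>x. fst (\<pi> x) = fst x"
  shows "sat A e (rename \<pi> \<phi>) \<longleftrightarrow> sat A (e \<circ> \<pi>) \<phi>"
proof (induction \<phi> arbitrary: e)
  case (Rel r ts)
  show ?case by (simp add: comp_def trm_val_rename)
next
  case (Exi x \<phi>)
  have "e(\<pi> x := a) \<circ> \<pi> = (e \<circ> \<pi>)(x := a)" for a
    using inj_eq[OF assms(1)] by (auto simp: fun_eq_iff)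
  then show ?case by (simp only: rename.simps sat.simps Exi assms(2))
qed (simp_all add: trm_val_rename)

lemma trm_sort_rename: "(\<And>x. fst (\<pi> x) = fst x) \<Longrightarrow> trm_sort L (rename_trm \<pi> t) = trm_sort L t"
  by (cases t) auto

lemma wf_rename_trm: "(\<And>x. fst (\<pi> x) = fst x) \<Longrightarrow> wf_trm L t \<Longrightarrow> wf_trm L (rename_trm \<pi> t)"
  by (induction t) (auto simp: comp_def trm_sort_rename)

lemma wf_rename: "(\<And>x. fst (\<pi> x) = fst x) \<Longrightarrow> wf_form L \<phi> \<Longrightarrow> wf_form L (rename \<pi> \<phi>)"
  by (induction \<phi>) (auto simp: comp_def trm_sort_rename wf_rename_trm)

text \<open>The seed \<open>x = x\<close> makes up for the absence of a formula \<open>True\<close>.\<close>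

definition conj_form :: "'s var \<Rightarrow> ('s, 'f, 'r) form list \<Rightarrow> ('s, 'f, 'r) form" where
  "conj_form x \<phi>s = foldr And \<phi>s (Eq (Var x) (Var x))"

lemma sat_conj_form: "sat A e (conj_form x \<phi>s) \<longleftrightarrow> (\<forall>\<phi>\<in>set \<phi>s. sat A e \<phi>)"
  by (induction \<phi>s) (auto simp: conj_form_def)

lemma wf_conj_form: "wf_form L (conj_form x \<phi>s) \<longleftrightarrow> (\<forall>\<phi>\<in>set \<phi>s. wf_form L \<phi>)"
  by (induction \<phi>s) (auto simp: conj_form_def)

lemma free_vars_conj_form: "free_vars (conj_form x \<phi>s) = insert x (\<Union>\<phi>\<in>set \<phi>s. free_vars \<phi>)"
  by (induction \<phi>s) (auto simp: conj_form_def)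

definition literal :: "('s, 'f, 'r) form \<Rightarrow> bool \<Rightarrow> ('s, 'f, 'r) form" where
  "literal \<phi> b = (if b then \<phi> else Neg \<phi>)"

lemma sat_literal: "sat A e (literal \<phi> b) \<longleftrightarrow> (sat A e \<phi> \<longleftrightarrow> b)"
  by (simp add: literal_def)

lemma wf_literal: "wf_form L (literal \<phi> b) \<longleftrightarrow> wf_form L \<phi>"
  by (simp add: literal_def)

lemma free_vars_literal: "free_vars (literal \<phi> b) = free_vars \<phi>"
  by (simp add: literal_def)

text \<open>A complete type over the finite list \<open>\<phi>s\<close>, with \<open>T\<close> as
  the set of formulas that hold. Quantifiers are later handled by asking which of the finitely many
  \<open>T\<close> are realised. The variable \<open>x\<close> only feeds the seed of
  \<open>conj_form\<close>.\<close>

definition type_form ::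
  "'s var \<Rightarrow> ('s, 'f, 'r) form list \<Rightarrow> ('s, 'f, 'r) form set \<Rightarrow> ('s, 'f, 'r) form" where
  "type_form x \<phi>s T = conj_form x (map (\<lambda>\<phi>. literal \<phi> (\<phi> \<in> T)) \<phi>s)"

lemma sat_type_form: "sat A e (type_form x \<phi>s T) \<longleftrightarrow> (\<forall>\<phi>\<in>set \<phi>s. sat A e \<phi> \<longleftrightarrow> \<phi> \<in> T)"
  by (simp add: type_form_def sat_conj_form sat_literal)

lemma wf_type_form: "wf_form L (type_form x \<phi>s T) \<longleftrightarrow> (\<forall>\<phi>\<in>set \<phi>s. wf_form L \<phi>)"
  by (simp add: type_form_def wf_conj_form wf_literal)

lemma free_vars_type_form:
  "free_vars (type_form x \<phi>s T) = insert x (\<Union>\<phi>\<in>set \<phi>s. free_vars \<phi>)"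
  by (simp add: type_form_def free_vars_conj_form free_vars_literal)

definition exi_list :: "'s var list \<Rightarrow> ('s, 'f, 'r) form \<Rightarrow> ('s, 'f, 'r) form" where
  "exi_list xs \<phi> = foldr Exi xs \<phi>"

lemma wf_exi_list: "wf_form L (exi_list xs \<phi>) \<longleftrightarrow> wf_form L \<phi>"
  by (induction xs) (auto simp: exi_list_def)

lemma free_vars_exi_list: "free_vars (exi_list xs \<phi>) = free_vars \<phi> - set xs"
  by (induction xs) (auto simp: exi_list_def)

lemma sat_exi_list_iff:
  assumes "assignment A e"
  shows "sat A e (exi_list xs \<phi>) \<longleftrightarrow>
    (\<exists>e'. assignment A e' \<and> (\<forall>x. x \<notin> set xs \<longrightarrow> e' x = e x) \<and> sat A e' \<phi>)"
  using assms
proof (induction xs arbitrary: e)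
  case Nil
  have "e' = e" if "\<forall>x. e' x = e x" for e' using that by auto
  then show ?case using Nil by (auto simp: exi_list_def)
next
  case (Cons x xs)
  show ?case
  proof
    assume "sat A e (exi_list (x # xs) \<phi>)"
    then obtain a where a: "a \<in> universe A (fst x)" "sat A (e(x := a)) (exi_list xs \<phi>)"
      by (auto simp: exi_list_def)
    then obtain e' where "assignment A e'" "\<forall>y. y \<notin> set xs \<longrightarrow> e' y = (e(x := a)) y" "sat A e' \<phi>"
      using Cons.IH[of "e(x := a)"] assignment_upd[OF Cons.prems] by blast
    then show "\<exists>e'. assignment A e' \<and> (\<forall>y. y \<notin> set (x # xs) \<longrightarrow> e' y = e y) \<and> sat A e' \<phi>"
      by (intro exI[of _ e']) auto
  next
    assume "\<exists>e'. assignment A e' \<and> (\<forall>y. y \<notin> set (x # xs) \<longrightarrow> e' y = e y) \<and> sat A e' \<phi>"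
    then obtain e' where e': "assignment A e'" "\<forall>y. y \<notin> set (x # xs) \<longrightarrow> e' y = e y" "sat A e' \<phi>"
      by blast
    have a: "e' x \<in> universe A (fst x)" using e'(1) by (simp only: assignment_def)
    have "\<forall>y. y \<notin> set xs \<longrightarrow> e' y = (e(x := e' x)) y" using e'(2) by simp
    then have "sat A (e(x := e' x)) (exi_list xs \<phi>)"
      using Cons.IH[OF assignment_upd[OF Cons.prems a]] e'(1,3) by blast
    then show "sat A e (exi_list (x # xs) \<phi>)" using a by (auto simp: exi_list_def)
  qed
qed

section \<open>Independent patterns expressed by sentences\<close>

abbreviation IP_at :: "('s, 'f, 'r, 'a) struct \<Rightarrow> ('s, 'f, 'r) form \<Rightarrow> 's var set \<Rightarrow> nat \<Rightarrow> bool" where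
  "IP_at A \<phi> X \<equiv> independent (Collect (assignment A)) (Collect (assignment A))
     (\<lambda>a b. sat A (override_on b a X) \<phi>)"

lemma has_IP_iff: "has_IP A \<phi> X \<longleftrightarrow> (\<forall>n. IP_at A \<phi> X n)"
proof
  assume IP: "has_IP A \<phi> X"
  show "\<forall>n. IP_at A \<phi> X n"
  proof
    fix n :: nat
    obtain a b where "\<forall>i<n. assignment A (a i)" "\<forall>I. I \<subseteq> {..<n} \<longrightarrow> assignment A (b I)"
      "\<forall>i<n. \<forall>I. I \<subseteq> {..<n} \<longrightarrow> (sat A (override_on (b I) (a i) X) \<phi> \<longleftrightarrow> i \<in> I)"
      using IP[unfolded has_IP_def, rule_format, of n] by (elim exE conjE)
    then show "IP_at A \<phi> X n"
      unfolding independent_def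
      by (intro exI[of _ a] conjI allI impI bexI[of _ "b _"]) auto
  qed
next
  assume IP: "\<forall>n. IP_at A \<phi> X n"
  show "has_IP A \<phi> X"
    unfolding has_IP_def
  proof
    fix n :: nat
    obtain a where a: "\<forall>i<n. assignment A (a i)"
      and b: "\<forall>I\<subseteq>{..<n}. \<exists>b. assignment A b \<and> (\<forall>i<n. sat A (override_on b (a i) X) \<phi> \<longleftrightarrow> i \<in> I)"
      using IP[rule_format, of n] by (auto simp: independent_def)
    obtain b where "\<forall>I\<subseteq>{..<n}. assignment A (b I) \<and>
        (\<forall>i<n. sat A (override_on (b I) (a i) X) \<phi> \<longleftrightarrow> i \<in> I)"
      using b by metis
    then show "\<exists>a b. (\<forall>i<n. assignment A (a i)) \<and> (\<forall>I. I \<subseteq> {..<n} \<longrightarrow> assignment A (b I)) \<and>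
        (\<forall>i<n. \<forall>I. I \<subseteq> {..<n} \<longrightarrow> (sat A (override_on (b I) (a i) X) \<phi> \<longleftrightarrow> i \<in> I))"
      using a by (intro exI[of _ a] exI[of _ b]) auto
  qed
qed

text \<open>
  In the sentence asserting an independent pattern, the tuple \<open>x\<close> has a copy for each \<open>i\<close>, coded
  by even numbers, and the tuple \<open>y\<close> has a copy for each \<open>I\<close>, coded by odd ones.
\<close>

definition copy_var :: "'s var set \<Rightarrow> nat \<Rightarrow> nat set \<Rightarrow> 's var \<Rightarrow> 's var" where
  "copy_var X i I x = (fst x,
     if x \<in> X then 2 * prod_encode (i, snd x) else Suc (2 * prod_encode (set_encode I, snd x)))"

lemma fst_copy_var [simp]: "fst (copy_var X i I x) = fst x"
  by (simp add: copy_var_def)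

lemma inj_copy_var: "inj (copy_var X i I)"
proof (rule injI)
  fix x y assume "copy_var X i I x = copy_var X i I y"
  then show "x = y"
    by (cases x; cases y) (auto simp: copy_var_def split: if_splits, presburger+)
qed

text \<open>The sort of the seed variable is arbitrary. That variable is free here and gets bound
  with all the others in \<open>IP_sentence\<close>.\<close>

definition IP_matrix :: "('s, 'f, 'r) form \<Rightarrow> 's var set \<Rightarrow> nat \<Rightarrow> ('s, 'f, 'r) form" where
  "IP_matrix \<phi> X n = conj_form (undefined, 0)
     (concat (map (\<lambda>i. map (\<lambda>I. literal (rename (copy_var X i I) \<phi>) (i \<in> I)) (map set (subseqs [0..<n])))
       [0..<n]))"

text \<open>A block of quantifiers needs a list, whereas the free variables form a finite set; any
  enumeration will do, and \<open>SOME\<close> picks one.\<close>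

definition IP_sentence :: "('s, 'f, 'r) form \<Rightarrow> 's var set \<Rightarrow> nat \<Rightarrow> ('s, 'f, 'r) form" where
  "IP_sentence \<phi> X n =
     exi_list (SOME xs. set xs = free_vars (IP_matrix \<phi> X n)) (IP_matrix \<phi> X n)"

lemma set_subseqs_upt: "set ` set (subseqs [0..<n]) = Pow {..<n}"
  by (simp add: subseqs_powset atLeast0LessThan)

lemma sat_IP_matrix:
  "sat A e (IP_matrix \<phi> X n) \<longleftrightarrow>
     (\<forall>i<n. \<forall>I\<subseteq>{..<n}. sat A (e \<circ> copy_var X i I) \<phi> \<longleftrightarrow> i \<in> I)"
proof -
  have "sat A e (IP_matrix \<phi> X n) \<longleftrightarrow>
     (\<forall>i<n. \<forall>I\<in>set ` set (subseqs [0..<n]). sat A (e \<circ> copy_var X i I) \<phi> \<longleftrightarrow> i \<in> I)"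
    by (auto simp: IP_matrix_def sat_conj_form sat_literal sat_rename inj_copy_var)
  then show ?thesis unfolding set_subseqs_upt by auto
qed

lemma IP_sentence_is_sentence: "wf_form L \<phi> \<Longrightarrow> is_sentence L (IP_sentence \<phi> X n)"
  using someI_ex[OF finite_list[OF finite_free_vars[of "IP_matrix \<phi> X n"]]]
  by (auto simp: is_sentence_def IP_sentence_def wf_exi_list free_vars_exi_list IP_matrix_def
      wf_conj_form wf_literal wf_rename)

lemma sat_IP_sentence:
  assumes "assignment A e"
  shows "sat A e (IP_sentence \<phi> X n) \<longleftrightarrow> IP_at A \<phi> X n"
proof -
  let ?F = "IP_matrix \<phi> X n"
  let ?xs = "SOME xs. set xs = free_vars ?F"
  have xs: "set ?xs = free_vars ?F"
    using someI_ex[OF finite_list[OF finite_free_vars[of ?F]]] .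
  have "sat A e (IP_sentence \<phi> X n) \<longleftrightarrow> (\<exists>e'. assignment A e' \<and> sat A e' ?F)"
  proof
    assume "sat A e (IP_sentence \<phi> X n)"
    then show "\<exists>e'. assignment A e' \<and> sat A e' ?F"
      unfolding IP_sentence_def sat_exi_list_iff[OF assms] by blast
  next
    assume "\<exists>e'. assignment A e' \<and> sat A e' ?F"
    then obtain e' where e': "assignment A e'" "sat A e' ?F" by blast
    \<comment> \<open>The quantifiers may change the free variables only, so elsewhere
      \<open>e'\<close> is replaced by \<open>e\<close>.\<close>
    then have "sat A (override_on e e' (free_vars ?F)) ?F"
      using sat_cong[of ?F e' "override_on e e' (free_vars ?F)"] by simp
    then show "sat A e (IP_sentence \<phi> X n)"
      unfolding IP_sentence_def sat_exi_list_iff[OF assms] xs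
      using assignment_override_on[OF assms e'(1), of "free_vars ?F"]
      by (intro exI[of _ "override_on e e' (free_vars ?F)"]) (simp add: override_on_def)
  qed
  also have "\<dots> \<longleftrightarrow> IP_at A \<phi> X n"
  proof
    assume "\<exists>e'. assignment A e' \<and> sat A e' ?F"
    then obtain e' where e': "assignment A e'"
      and s: "\<And>i I. i < n \<Longrightarrow> I \<subseteq> {..<n} \<Longrightarrow> sat A (e' \<circ> copy_var X i I) \<phi> \<longleftrightarrow> i \<in> I"
      unfolding sat_IP_matrix by blast
    define a where "a = (\<lambda>i (x :: 'a var). e' (fst x, 2 * prod_encode (i, snd x)))"
    define b where "b = (\<lambda>I (x :: 'a var). e' (fst x, Suc (2 * prod_encode (set_encode I, snd x))))"
    have "e' \<circ> copy_var X i I = override_on (b I) (a i) X" for i I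
      by (auto simp: fun_eq_iff copy_var_def override_on_def a_def b_def)
    then have "\<forall>i<n. \<forall>I\<subseteq>{..<n}. sat A (override_on (b I) (a i) X) \<phi> \<longleftrightarrow> i \<in> I"
      using s by simp
    moreover have "assignment A (a i)" "assignment A (b I)" for i I
      using e' by (auto simp: assignment_def a_def b_def)
    ultimately show "IP_at A \<phi> X n"
      unfolding independent_def by (intro exI[of _ a] conjI allI impI bexI[of _ "b _"]) auto
  next
    assume "IP_at A \<phi> X n"
    then obtain a where a: "\<And>i. i < n \<Longrightarrow> assignment A (a i)"
      and "\<forall>I\<subseteq>{..<n}. \<exists>b. assignment A b \<and> (\<forall>i<n. sat A (override_on b (a i) X) \<phi> \<longleftrightarrow> i \<in> I)"
      unfolding independent_def by (metis mem_Collect_eq)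
    then obtain b where b: "\<And>I. I \<subseteq> {..<n} \<Longrightarrow> assignment A (b I)"
      "\<And>I i. I \<subseteq> {..<n} \<Longrightarrow> i < n \<Longrightarrow> sat A (override_on (b I) (a i) X) \<phi> \<longleftrightarrow> i \<in> I"
      by metis
    \<comment> \<open>The assignment \<open>e'\<close> must give every variable a value of the right
      sort, including the copies that belong to no tuple of the pattern; \<open>e\<close> supplies
      these values.\<close>
    define a' where "a' = (\<lambda>i. if i < n then a i else e)"
    define b' where "b' = (\<lambda>I. if I \<subseteq> {..<n} then b I else e)"
    have a': "assignment A (a' i)" and b': "assignment A (b' I)" for i I
      using a b assms by (auto simp: a'_def b'_def)
    define e' where "e' = (\<lambda>(s :: 'a, m).
      case prod_decode (m div 2) of (i, k) \<Rightarrow> if even m then a' i (s, k) else b' (set_decode i) (s, k))"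
    have "assignment A e'"
      using a' b' by (auto simp: assignment_def e'_def split: prod.split)
    moreover have "e' \<circ> copy_var X i I = override_on (b I) (a i) X" if "i < n" "I \<subseteq> {..<n}" for i I
    proof -
      \<comment> \<open>Decoding with \<open>set_decode\<close> recovers finite sets only.\<close>
      have "finite I" using that(2) finite_subset by blast
      then show ?thesis
        using that by (auto simp: fun_eq_iff copy_var_def override_on_def e'_def a'_def b'_def set_encode_inverse)
    qed
    ultimately show "\<exists>e'. assignment A e' \<and> sat A e' ?F"
      unfolding sat_IP_matrix using b(2) by (intro exI[of _ e']) auto
  qed
  finally show ?thesis .
qed

section \<open>Ultraproducts of the fibres\<close>

locale ultraproduct_structure =
  fixes L :: "(unit, 'g, 'q) language"
    and J :: "'i set" and F :: "'i filter"
    and N :: "'i \<Rightarrow> (unit, 'g, 'q, 'b) struct"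
  assumes ultrafilter: "ultrafilter_on J F"
    and fibres: "a \<in> J \<Longrightarrow> is_structure L (N a)"
begin

abbreviation "sections \<equiv> \<Pi>\<^sub>E a\<in>J. universe (N a) ()"

abbreviation "cls g \<equiv> ultra_rel J F N `` {g}"

abbreviation "U \<equiv> ultraproduct J F N"

lemma eventually_index: "eventually (\<lambda>a. a \<in> J) F"
  using ultrafilter by (simp add: ultrafilter_on_def le_principal)

lemma eventually_congI:
  "(\<And>a. a \<in> J \<Longrightarrow> P a \<longleftrightarrow> Q a) \<Longrightarrow> eventually P F \<longleftrightarrow> eventually Q F"
  by (rule eventually_cong[OF eventually_index])

lemma eventually_not: "eventually (\<lambda>a. \<not> P a) F \<longleftrightarrow> \<not> eventually P F"
proof -
  have "\<not> (eventually P F \<and> eventually (\<lambda>a. \<not> P a) F)"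
    using ultrafilter eventually_conj[of P F "\<lambda>a. \<not> P a"]
    by (auto simp: ultrafilter_on_def trivial_limit_def)
  then show ?thesis using ultrafilter by (auto simp: ultrafilter_on_def)
qed

lemma equiv_ultra_rel: "equiv sections (ultra_rel J F N)"
proof (rule equivI)
  show "ultra_rel J F N \<subseteq> sections \<times> sections" by (auto simp: ultra_rel_def)
  show "refl_on sections (ultra_rel J F N)" by (auto simp: refl_on_def ultra_rel_def)
  show "sym (ultra_rel J F N)" by (auto simp: sym_def ultra_rel_def eq_commute)
  show "trans (ultra_rel J F N)"
    unfolding trans_def ultra_rel_def by (auto elim: eventually_elim2)
qed

lemma universe_U: "universe U s = sections // ultra_rel J F N"
  by (simp add: ultraproduct_def)

lemma cls_eq_iff:
  "g \<in> sections \<Longrightarrow> h \<in> sections \<Longrightarrow> cls g = cls h \<longleftrightarrow> eventually (\<lambda>a. g a = h a) F"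
  using eq_equiv_class_iff[OF equiv_ultra_rel] by (auto simp: ultra_rel_def)

text \<open>\<open>ultraproduct\<close> interprets symbols through representatives chosen by
  \<open>SOME\<close>. The chosen one need not be \<open>g\<close> and agrees with it only almost
  everywhere.\<close>

lemma eventually_some_cls:
  assumes "g \<in> sections"
  shows "eventually (\<lambda>a. (SOME h. h \<in> cls g) a = g a) F"
proof -
  have "g \<in> cls g" using assms by (auto simp: ultra_rel_def)
  then have "(SOME h. h \<in> cls g) \<in> cls g" by (rule someI[of "\<lambda>h. h \<in> cls g"])
  then show ?thesis by (auto simp: ultra_rel_def eq_commute)
qed

lemma eventually_map_some_cls:
  assumes "\<And>x. x \<in> set xs \<Longrightarrow> g x \<in> sections"
  shows "eventually (\<lambda>a. map (\<lambda>C. (SOME h. h \<in> C) a) (map (\<lambda>x. cls (g x)) xs) = map (\<lambda>x. g x a) xs) F"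
proof -
  have "eventually (\<lambda>a. \<forall>x\<in>set xs. (SOME h. h \<in> cls (g x)) a = g x a) F"
    using assms by (intro eventually_ball_finite ballI eventually_some_cls) auto
  then show ?thesis by eventually_elim simp
qed

definition trm_section :: "(unit var \<Rightarrow> 'i \<Rightarrow> 'b) \<Rightarrow> (unit, 'g) trm \<Rightarrow> 'i \<Rightarrow> 'b" where
  "trm_section e t = (\<lambda>a\<in>J. trm_val (N a) (\<lambda>x. e x a) t)"

lemma trm_section:
  assumes "wf_trm L t" "\<And>x. e x \<in> sections"
  shows "trm_section e t \<in> sections"
proof -
  have "trm_val (N a) (\<lambda>x. e x a) t \<in> universe (N a) ()" if a: "a \<in> J" for a
  proof -
    have "assignment (N a) (\<lambda>x. e x a)"
      using assms(2) a by (auto simp: assignment_def PiE_def Pi_def)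
    from trm_val_in_universe[OF fibres[OF a] this assms(1)] show ?thesis by simp
  qed
  then show ?thesis by (auto simp: trm_section_def)
qed

lemma trm_val_U:
  assumes "wf_trm L t" and e: "\<And>x. e x \<in> sections"
  shows "trm_val U (\<lambda>x. cls (e x)) t = cls (trm_section e t)"
  using assms(1)
proof (induction t)
  case (Var x)
  have "trm_section e (Var x) = e x"
    using e[of x] by (auto simp: trm_section_def fun_eq_iff PiE_def extensional_def)
  then show ?case by simp
next
  case (Fn f ts)
  let ?g = "\<lambda>a\<in>J. fint (N a) f
    (map (\<lambda>C. (SOME h. h \<in> C) a) (map (\<lambda>t. cls (trm_section e t)) ts))"
  have ts: "trm_section e t \<in> sections" if "t \<in> set ts" for t
    using trm_section e Fn.prems that by auto
  have "map (trm_val U (\<lambda>x. cls (e x))) ts = map (\<lambda>t. cls (trm_section e t)) ts"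
    using Fn by (intro map_cong) auto
  then have val: "trm_val U (\<lambda>x. cls (e x)) (Fn f ts) = cls ?g"
    by (simp add: ultraproduct_def del: map_eq_conv map_map)
  have "eventually (\<lambda>a. map (\<lambda>C. (SOME h. h \<in> C) a) (map (\<lambda>t. cls (trm_section e t)) ts) =
      map (\<lambda>t. trm_section e t a) ts) F"
    by (rule eventually_map_some_cls[of ts "trm_section e", OF ts])
  then have ev: "eventually (\<lambda>a. ?g a = trm_section e (Fn f ts) a) F"
    using eventually_index
  proof eventually_elim
    case (elim a)
    have "map (\<lambda>t. trm_section e t a) ts = map (trm_val (N a) (\<lambda>x. e x a)) ts"
      using elim(2) by (simp add: trm_section_def)
    then show ?case using elim by (simp add: trm_section_def del: map_map map_eq_conv)
  qed
  \<comment> \<open>A section is required to have its values in the fibres at every index of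
    \<open>J\<close>, so \<open>ev\<close> does not help; what does is that the chosen
    representatives are themselves sections.\<close>
  have g: "?g \<in> sections"
  proof (rule restrict_PiE_iff[THEN iffD2], rule ballI)
    fix a assume a: "a \<in> J"
    have "(SOME h. h \<in> cls (trm_section e t)) a \<in> universe (N a) ()" if "t \<in> set ts" for t
    proof -
      have "trm_section e t \<in> cls (trm_section e t)" using ts[OF that] by (auto simp: ultra_rel_def)
      then have "(SOME h. h \<in> cls (trm_section e t)) \<in> cls (trm_section e t)"
        by (rule someI[of "\<lambda>h. h \<in> cls (trm_section e t)"])
      then have "(SOME h. h \<in> cls (trm_section e t)) \<in> sections" by (auto simp: ultra_rel_def)
      then show ?thesis using a by (auto simp: PiE_def Pi_def)
    qed
    moreover have "length ts = length (fdom L f)" "f \<in> fsyms L"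
      using Fn.prems by (auto dest: arg_cong[of _ _ length])
    ultimately have "fint (N a) f (map (\<lambda>C. (SOME h. h \<in> C) a) (map (\<lambda>t. cls (trm_section e t)) ts))
        \<in> universe (N a) (fcod L f)"
      using fibres[OF a] unfolding is_structure_def by (auto simp: list_all2_conv_all_nth)
    then show "fint (N a) f (map (\<lambda>C. (SOME h. h \<in> C) a) (map (\<lambda>t. cls (trm_section e t)) ts))
        \<in> universe (N a) ()" by simp
  qed
  show ?case
    unfolding val cls_eq_iff[OF g trm_section[OF Fn.prems e]] by (rule ev)
qed

theorem Los:
  assumes "wf_form L \<phi>" and "\<And>x. e x \<in> sections"
  shows "sat U (\<lambda>x. cls (e x)) \<phi> \<longleftrightarrow> eventually (\<lambda>a. sat (N a) (\<lambda>x. e x a) \<phi>) F"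
  using assms
proof (induction \<phi> arbitrary: e)
  case (Eq t u)
  then have wf: "wf_trm L t" "wf_trm L u" by simp_all
  have "sat U (\<lambda>x. cls (e x)) (Eq t u) \<longleftrightarrow> eventually (\<lambda>a. trm_section e t a = trm_section e u a) F"
    using cls_eq_iff trm_section[OF wf(1) Eq.prems(2)] trm_section[OF wf(2) Eq.prems(2)]
    by (simp add: trm_val_U[OF wf(1) Eq.prems(2)] trm_val_U[OF wf(2) Eq.prems(2)])
  also have "\<dots> \<longleftrightarrow> eventually (\<lambda>a. sat (N a) (\<lambda>x. e x a) (Eq t u)) F"
    by (rule eventually_congI) (simp add: trm_section_def)
  finally show ?case .
next
  case (Rel r ts)
  then have wf: "wf_trm L t" if "t \<in> set ts" for t using that by simp
  have "map (trm_val U (\<lambda>x. cls (e x))) ts = map (\<lambda>t. cls (trm_section e t)) ts"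
    using trm_val_U wf Rel.prems(2) by (intro map_cong) auto
  then have "sat U (\<lambda>x. cls (e x)) (Rel r ts) \<longleftrightarrow> eventually (\<lambda>a. rint (N a) r
      (map (\<lambda>C. (SOME h. h \<in> C) a) (map (\<lambda>t. cls (trm_section e t)) ts))) F"
    by (simp add: ultraproduct_def del: map_eq_conv map_map)
  also have "\<dots> \<longleftrightarrow> eventually (\<lambda>a. rint (N a) r (map (\<lambda>t. trm_section e t a) ts)) F"
  proof (rule eventually_cong[OF eventually_map_some_cls[of ts "trm_section e"]])
    show "trm_section e t \<in> sections" if "t \<in> set ts" for t
      using trm_section wf that Rel.prems(2) by blast
  qed (simp del: map_map map_eq_conv)
  also have "\<dots> \<longleftrightarrow> eventually (\<lambda>a. sat (N a) (\<lambda>x. e x a) (Rel r ts)) F"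
  proof (rule eventually_congI)
    fix a assume "a \<in> J"
    then have "map (\<lambda>t. trm_section e t a) ts = map (trm_val (N a) (\<lambda>x. e x a)) ts"
      by (simp add: trm_section_def)
    then show "rint (N a) r (map (\<lambda>t. trm_section e t a) ts) \<longleftrightarrow> sat (N a) (\<lambda>x. e x a) (Rel r ts)"
      by (simp del: map_eq_conv)
  qed
  finally show ?case .
next
  case (Neg \<phi>)
  then show ?case by (simp add: eventually_not)
next
  case (And \<phi> \<psi>)
  then show ?case by (simp add: eventually_conj_iff)
next
  case (Exi x \<phi>)
  have upd: "(\<lambda>y. cls ((e(x := g)) y)) = (\<lambda>y. cls (e y))(x := cls g)"
    "(\<lambda>y. (e(x := g)) y a) = (\<lambda>y. e y a)(x := g a)" for g a
    by (simp_all add: fun_eq_iff)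
  have IH: "sat U ((\<lambda>y. cls (e y))(x := cls g)) \<phi> \<longleftrightarrow>
      eventually (\<lambda>a. sat (N a) ((\<lambda>y. e y a)(x := g a)) \<phi>) F" if "g \<in> sections" for g
    using Exi.IH[of "e(x := g)"] Exi.prems that unfolding upd by auto
  have "sat U (\<lambda>x. cls (e x)) (Exi x \<phi>) \<longleftrightarrow>
      (\<exists>g\<in>sections. sat U ((\<lambda>y. cls (e y))(x := cls g)) \<phi>)"
    by (auto simp: universe_U quotient_def)
  also have "\<dots> \<longleftrightarrow> (\<exists>g\<in>sections. eventually (\<lambda>a. sat (N a) ((\<lambda>y. e y a)(x := g a)) \<phi>) F)"
    using IH by blast
  also have "\<dots> \<longleftrightarrow> eventually (\<lambda>a. sat (N a) (\<lambda>x. e x a) (Exi x \<phi>)) F"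
  proof
    assume "\<exists>g\<in>sections. eventually (\<lambda>a. sat (N a) ((\<lambda>y. e y a)(x := g a)) \<phi>) F"
    then obtain g where g: "g \<in> sections" "eventually (\<lambda>a. sat (N a) ((\<lambda>y. e y a)(x := g a)) \<phi>) F"
      by blast
    from g(2) eventually_index show "eventually (\<lambda>a. sat (N a) (\<lambda>x. e x a) (Exi x \<phi>)) F"
    proof eventually_elim
      case (elim a)
      then have "g a \<in> universe (N a) ()" using g(1) by (auto simp: PiE_def Pi_def)
      then show ?case using elim by auto
    qed
  next
    assume ev: "eventually (\<lambda>a. sat (N a) (\<lambda>x. e x a) (Exi x \<phi>)) F"
    \<comment> \<open>A witness is chosen wherever there is one; elsewhere the default
      \<open>e x a\<close> keeps \<open>g\<close> a section.\<close>
    define g where "g = (\<lambda>a\<in>J. if sat (N a) (\<lambda>x. e x a) (Exi x \<phi>)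
      then SOME b. b \<in> universe (N a) () \<and> sat (N a) ((\<lambda>y. e y a)(x := b)) \<phi> else e x a)"
    have g: "g a \<in> universe (N a) () \<and> (sat (N a) (\<lambda>x. e x a) (Exi x \<phi>) \<longrightarrow>
        sat (N a) ((\<lambda>y. e y a)(x := g a)) \<phi>)" if a: "a \<in> J" for a
    proof (cases "sat (N a) (\<lambda>x. e x a) (Exi x \<phi>)")
      case True
      then have "\<exists>b. b \<in> universe (N a) () \<and> sat (N a) ((\<lambda>y. e y a)(x := b)) \<phi>" by auto
      from someI_ex[OF this] show ?thesis using True a by (simp add: g_def)
    next
      case False
      then show ?thesis using a Exi.prems(2)[of x] by (auto simp: g_def PiE_def Pi_def)
    qed
    have "g \<in> sections"
    proof (rule PiE_I)
      show "g a \<in> universe (N a) ()" if "a \<in> J" for a using g[OF that] by blast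
      show "g a = undefined" if "a \<notin> J" for a using that by (simp add: g_def)
    qed
    moreover have "eventually (\<lambda>a. sat (N a) ((\<lambda>y. e y a)(x := g a)) \<phi>) F"
      using ev eventually_index by eventually_elim (use g in blast)
    ultimately show "\<exists>g\<in>sections. eventually (\<lambda>a. sat (N a) ((\<lambda>y. e y a)(x := g a)) \<phi>) F"
      by blast
  qed
  finally show ?case .
qed

text \<open>A sentence has no parameters, so the theorem of Los can be applied with one arbitrary
  section as the value of all variables.\<close>

lemma IP_at_ultraproduct:
  assumes "wf_form L \<phi>" and ev: "eventually (\<lambda>a. models (N a) (IP_sentence \<phi> X n)) F"
  shows "IP_at U \<phi> X n"
proof -
  have "\<forall>a. \<exists>b. a \<in> J \<longrightarrow> b \<in> universe (N a) ()"
    using fibres unfolding is_structure_def by blast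
  then obtain c where c: "a \<in> J \<Longrightarrow> c a \<in> universe (N a) ()" for a by metis
  define e where "e = (\<lambda>x :: unit var. restrict c J)"
  have e: "e x \<in> sections" for x using c by (auto simp: e_def)
  have asg: "assignment U (\<lambda>x. cls (e x))"
    using e by (auto simp: assignment_def universe_U quotient_def)
  have "eventually (\<lambda>a. sat (N a) (\<lambda>x. e x a) (IP_sentence \<phi> X n)) F"
    using ev eventually_index
  proof eventually_elim
    case (elim a)
    then have "assignment (N a) (\<lambda>x. e x a)" using c by (auto simp: assignment_def e_def)
    then show ?case using elim(1) by (simp add: models_def)
  qed
  moreover have "wf_form L (IP_sentence \<phi> X n)"
    using IP_sentence_is_sentence[OF assms(1)] by (simp add: is_sentence_def)
  ultimately have "sat U (\<lambda>x. cls (e x)) (IP_sentence \<phi> X n)"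
    using Los[of _ e] e by blast
  then show ?thesis by (simp only: sat_IP_sentence[OF asg])
qed

end

section \<open>Complete types and the uniform bound for the fibres\<close>

text \<open>Lindenbaum's argument. Finite satisfiability has finite character, so Zorn's lemma gives
  a maximal set. If it omitted both \<open>\<phi>\<close> and \<open>Neg \<phi>\<close>, the finite
  obstructions \<open>\<Phi>\<close> and \<open>\<Psi>\<close> to adding them would have a common
  solution, which could satisfy neither of the two.\<close>

lemma extend_to_complete_1_type:
  assumes M: "is_structure L M"
    and \<Sigma>: "\<Sigma> \<subseteq> unary_forms L"
    and fin: "\<And>\<Phi>. finite \<Phi> \<Longrightarrow> \<Phi> \<subseteq> \<Sigma> \<Longrightarrow> \<exists>a\<in>universe M (). \<forall>\<phi>\<in>\<Phi>. a \<in> solutions M \<phi>"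
  obtains \<rho> where "\<rho> \<in> complete_1_types L M" "\<Sigma> \<subseteq> \<rho>"
proof -
  define fs where "fs = (\<lambda>\<rho>. \<forall>\<Phi>. finite \<Phi> \<and> \<Phi> \<subseteq> \<rho> \<longrightarrow>
    (\<exists>a\<in>universe M (). \<forall>\<phi>\<in>\<Phi>. a \<in> solutions M \<phi>))"
  define \<A> where "\<A> = {\<rho>. \<Sigma> \<subseteq> \<rho> \<and> \<rho> \<subseteq> unary_forms L \<and> fs \<rho>}"
  have "\<exists>\<rho>\<in>\<A>. \<forall>\<sigma>\<in>\<A>. \<rho> \<subseteq> \<sigma> \<longrightarrow> \<sigma> = \<rho>"
  proof (rule subset_Zorn_nonempty)
    have "fs \<Sigma>" unfolding fs_def using fin by blast
    then have "\<Sigma> \<in> \<A>" using \<Sigma> by (simp add: \<A>_def)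
    then show "\<A> \<noteq> {}" by blast
  next
    fix C assume C: "C \<noteq> {}" "subset.chain \<A> C"
    then have CA: "C \<subseteq> \<A>" by (simp add: subset_chain_def)
    have "fs (\<Union>C)"
      unfolding fs_def
    proof (intro allI impI)
      fix \<Phi> assume \<Phi>: "finite \<Phi> \<and> \<Phi> \<subseteq> \<Union>C"
      then obtain \<rho> where "\<rho> \<in> C" "\<Phi> \<subseteq> \<rho>"
        using finite_subset_Union_chain[of \<Phi> C \<A>] C by blast
      then show "\<exists>a\<in>universe M (). \<forall>\<phi>\<in>\<Phi>. a \<in> solutions M \<phi>"
        using CA \<Phi> by (auto simp: \<A>_def fs_def)
    qed
    then show "\<Union>C \<in> \<A>" using C CA by (fastforce simp: \<A>_def)
  qed
  then obtain \<rho> where \<rho>: "\<rho> \<in> \<A>" and max: "\<And>\<sigma>. \<sigma> \<in> \<A> \<Longrightarrow> \<rho> \<subseteq> \<sigma> \<Longrightarrow> \<sigma> = \<rho>" by blast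
  have bad: "\<exists>\<Phi>. finite \<Phi> \<and> \<Phi> \<subseteq> \<rho> \<and> (\<forall>a\<in>universe M (). (\<forall>\<psi>\<in>\<Phi>. a \<in> solutions M \<psi>) \<longrightarrow> a \<notin> solutions M \<phi>)"
    if \<phi>: "\<phi> \<in> unary_forms L" "\<phi> \<notin> \<rho>" for \<phi>
  proof -
    have "insert \<phi> \<rho> \<notin> \<A>" using max[of "insert \<phi> \<rho>"] \<phi>(2) by auto
    then have "\<not> fs (insert \<phi> \<rho>)" using \<rho> \<phi>(1) by (auto simp: \<A>_def)
    then obtain \<Phi> where \<Phi>: "finite \<Phi>" "\<Phi> \<subseteq> insert \<phi> \<rho>"
      "\<not> (\<exists>a\<in>universe M (). \<forall>\<psi>\<in>\<Phi>. a \<in> solutions M \<psi>)"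
      by (auto simp only: fs_def not_all not_imp)
    have "a \<notin> solutions M \<phi>" if "a \<in> universe M ()" "\<forall>\<psi>\<in>\<Phi> - {\<phi>}. a \<in> solutions M \<psi>" for a
      using \<Phi>(3) that by (metis Diff_iff singletonD)
    then show ?thesis using \<Phi>(1,2) by (intro exI[of _ "\<Phi> - {\<phi>}"]) blast
  qed
  have "\<phi> \<in> \<rho> \<or> Neg \<phi> \<in> \<rho>" if \<phi>: "\<phi> \<in> unary_forms L" for \<phi>
  proof (rule ccontr)
    assume "\<not> (\<phi> \<in> \<rho> \<or> Neg \<phi> \<in> \<rho>)"
    then have "\<phi> \<notin> \<rho>" "Neg \<phi> \<notin> \<rho>" by simp_all
    moreover have "Neg \<phi> \<in> unary_forms L" using \<phi> by (simp add: unary_forms_def)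
    ultimately obtain \<Phi> \<Psi> where 1: "finite \<Phi>" "\<Phi> \<subseteq> \<rho>" "finite \<Psi>" "\<Psi> \<subseteq> \<rho>"
      and 2: "\<And>a. a \<in> universe M () \<Longrightarrow> \<forall>\<psi>\<in>\<Phi>. a \<in> solutions M \<psi> \<Longrightarrow> a \<notin> solutions M \<phi>"
      and 3: "\<And>a. a \<in> universe M () \<Longrightarrow> \<forall>\<psi>\<in>\<Psi>. a \<in> solutions M \<psi> \<Longrightarrow> a \<notin> solutions M (Neg \<phi>)"
      using bad[OF \<phi>] bad[of "Neg \<phi>"] by metis
    have "fs \<rho>" using \<rho> by (simp add: \<A>_def)
    then obtain a where "a \<in> universe M ()" "\<forall>\<psi>\<in>\<Phi> \<union> \<Psi>. a \<in> solutions M \<psi>"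
      using 1 unfolding fs_def by (metis finite_Un le_sup_iff)
    then show False using 2[of a] 3[of a] by (auto simp: solutions_def)
  qed
  then have "\<rho> \<in> complete_1_types L M"
    using \<rho> by (auto simp: complete_1_types_def \<A>_def fs_def)
  then show ?thesis using that \<rho> by (auto simp: \<A>_def)
qed

lemma fibres_uniformly_NIP:
  assumes M: "is_structure LM M"
    and N: "\<And>a. a \<in> universe M () \<Longrightarrow> is_structure LN (N a)"
    and def: "\<And>\<phi>. is_sentence LN \<phi> \<Longrightarrow> zero_definable LM M {a \<in> universe M (). models (N a) \<phi>}"
    and ultra: "\<And>\<rho>. \<rho> \<in> complete_1_types LM M \<Longrightarrow>
           ultrafilter_on (universe M ()) (\<U> \<rho>) \<and>
           (\<forall>\<phi>\<in>\<rho>. eventually (\<lambda>a. a \<in> solutions M \<phi>) (\<U> \<rho>))"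
    and NIP: "\<And>\<rho>. \<rho> \<in> complete_1_types LM M \<Longrightarrow> NIP LN (ultraproduct (universe M ()) (\<U> \<rho>) N)"
    and wf: "wf_form LN \<gamma>"
  shows "\<exists>n. \<forall>a\<in>universe M (). \<not> IP_at (N a) \<gamma> X n"
proof (rule ccontr)
  assume "\<not> ?thesis"
  then have ex: "\<exists>a\<in>universe M (). IP_at (N a) \<gamma> X n" for n by (simp only: not_ex) simp
  have "\<exists>\<chi>\<in>unary_forms LM. {a \<in> universe M (). models (N a) (IP_sentence \<gamma> X n)} = solutions M \<chi>" for n
    using def[OF IP_sentence_is_sentence[OF wf]] by (simp add: zero_definable_def)
  then obtain \<chi> where \<chi>: "\<And>n. \<chi> n \<in> unary_forms LM"
    "\<And>n. {a \<in> universe M (). models (N a) (IP_sentence \<gamma> X n)} = solutions M (\<chi> n)"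
    by metis
  have IP: "models (N a) (IP_sentence \<gamma> X n) \<longleftrightarrow> IP_at (N a) \<gamma> X n" if "a \<in> universe M ()" for a n
    using ex_assignment[OF N[OF that]] models_iff_sat[OF IP_sentence_is_sentence[OF wf]] sat_IP_sentence
    by metis
  obtain \<rho> where \<rho>: "\<rho> \<in> complete_1_types LM M" "range \<chi> \<subseteq> \<rho>"
  proof (rule extend_to_complete_1_type[OF M, of "range \<chi>"])
    show "range \<chi> \<subseteq> unary_forms LM" using \<chi>(1) by auto
  next
    fix \<Phi> assume "finite \<Phi>" "\<Phi> \<subseteq> range \<chi>"
    then obtain K where K: "finite K" "\<Phi> = \<chi> ` K" using finite_subset_image by metis
    \<comment> \<open>A pattern of size \<open>m\<close> contains patterns of all smaller sizes, so
      a single index meets all of the finitely many conditions.\<close>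
    obtain m where m: "\<forall>n\<in>K. n \<le> m" using K(1) finite_nat_set_iff_bounded_le by blast
    obtain a where a: "a \<in> universe M ()" "IP_at (N a) \<gamma> X m" using ex by blast
    have "a \<in> solutions M (\<chi> n)" if "n \<in> K" for n
      using a IP independent_mono[OF a(2)] m that \<chi>(2)[of n, symmetric] by auto
    then show "\<exists>a\<in>universe M (). \<forall>\<phi>\<in>\<Phi>. a \<in> solutions M \<phi>" using a K(2) by blast
  qed
  interpret ultraproduct_structure LN "universe M ()" "\<U> \<rho>" N
    using ultra[OF \<rho>(1)] N by unfold_locales auto
  have "IP_at U \<gamma> X n" for n
  proof (rule IP_at_ultraproduct[OF wf])
    have "eventually (\<lambda>a. a \<in> solutions M (\<chi> n)) (\<U> \<rho>)" using ultra[OF \<rho>(1)] \<rho>(2) by blast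
    then show "eventually (\<lambda>a. models (N a) (IP_sentence \<gamma> X n)) (\<U> \<rho>)"
      by eventually_elim (use \<chi>(2)[of n] in blast)
  qed
  then show False using NIP[OF \<rho>(1)] wf unfolding NIP_def has_IP_iff by blast
qed

section \<open>Predicates determined by the index structure and the fibres\<close>

text \<open>
  Points of the sum and elements of the index structure are both described by an index and an
  optional element of the fibre over it.
\<close>

type_synonym ('a, 'b) env = "nat \<Rightarrow> 'a \<times> 'b option"

definition fv_idx :: "(unit, 'f, 'r) form \<Rightarrow> nat set" where
  "fv_idx \<phi> = snd ` free_vars \<phi>"

lemma fv_idx_iff: "k \<in> fv_idx \<phi> \<longleftrightarrow> ((), k) \<in> free_vars \<phi>"
  by (force simp: fv_idx_def)

lemma finite_fv_idx: "finite (fv_idx \<phi>)"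
  by (simp add: fv_idx_def finite_free_vars)

definition index_env :: "('a, 'b) env \<Rightarrow> unit var \<Rightarrow> 'a" where
  "index_env e = (\<lambda>x. fst (e (snd x)))"

lemma index_env_upd: "index_env (e(k := v)) = (index_env e)(((), k) := fst v)"
  by (auto simp: index_env_def fun_eq_iff)

definition lies_over :: "('a, 'b) env \<Rightarrow> 'a \<Rightarrow> nat \<Rightarrow> bool" where
  "lies_over e a k \<longleftrightarrow> fst (e k) = a \<and> snd (e k) \<noteq> None"

locale definable_fibres =
  fixes LM :: "(unit, 'f, 'r) language"
    and LN :: "(unit, 'g, 'q) language"
    and M :: "(unit, 'f, 'r, 'a) struct"
    and N :: "'a \<Rightarrow> (unit, 'g, 'q, 'b) struct"
  assumes index_structure: "is_structure LM M"
    and fibre_structure: "a \<in> universe M () \<Longrightarrow> is_structure LN (N a)"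
    and definable: "is_sentence LN \<phi> \<Longrightarrow> zero_definable LM M {a \<in> universe M (). models (N a) \<phi>}"
begin

definition valid :: "('a, 'b) env \<Rightarrow> bool" where
  "valid e \<longleftrightarrow> (\<forall>k. fst (e k) \<in> universe M () \<and>
     (\<forall>b. snd (e k) = Some b \<longrightarrow> b \<in> universe (N (fst (e k))) ()))"

text \<open>Positions that do not lie over \<open>a\<close> get an arbitrary element, so that the
  result is an assignment of \<open>N a\<close>. The truth of \<open>fibre_pred\<close> is not
  affected: it is false unless all positions of its formula lie over one index.\<close>

definition fibre_env :: "'a \<Rightarrow> ('a, 'b) env \<Rightarrow> unit var \<Rightarrow> 'b" where
  "fibre_env a e = (\<lambda>x. if lies_over e a (snd x) then the (snd (e (snd x)))
     else SOME b. b \<in> universe (N a) ())"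

definition index_pred :: "(unit, 'f, 'r) form \<Rightarrow> ('a, 'b) env \<Rightarrow> bool" where
  "index_pred \<delta> e \<longleftrightarrow> sat M (index_env e) \<delta>"

text \<open>The anchor \<open>w\<close> names the fibre, which the free variables cannot do, since
  \<open>\<gamma>\<close> may have none. For a reflexive equation the predicate just says that its
  positions and \<open>w\<close> hold points of one fibre.\<close>

definition fibre_pred :: "nat \<Rightarrow> (unit, 'g, 'q) form \<Rightarrow> ('a, 'b) env \<Rightarrow> bool" where
  "fibre_pred w \<gamma> e \<longleftrightarrow> (\<forall>k\<in>insert w (fv_idx \<gamma>). lies_over e (fst (e w)) k) \<and>
     sat (N (fst (e w))) (fibre_env (fst (e w)) e) \<gamma>"

lemma validD: "valid e \<Longrightarrow> fst (e k) \<in> universe M ()"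
  by (simp add: valid_def)

lemma valid_upd_None: "valid e \<Longrightarrow> a \<in> universe M () \<Longrightarrow> valid (e(k := (a, None)))"
  by (simp add: valid_def)

lemma valid_upd_Some:
  "valid e \<Longrightarrow> a \<in> universe M () \<Longrightarrow> b \<in> universe (N a) () \<Longrightarrow> valid (e(k := (a, Some b)))"
  by (simp add: valid_def)

lemma valid_override_on: "valid e \<Longrightarrow> valid e' \<Longrightarrow> valid (override_on e e' X)"
  by (auto simp: valid_def override_on_def)

lemma assignment_index_env: "valid e \<Longrightarrow> assignment M (index_env e)"
  by (auto simp: valid_def assignment_def index_env_def)

lemma assignment_fibre_env:
  assumes "valid e" "a \<in> universe M ()"
  shows "assignment (N a) (fibre_env a e)"
proof -
  have "\<exists>b. b \<in> universe (N a) ()"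
    using fibre_structure[OF assms(2)] unfolding is_structure_def by blast
  then have "(SOME b. b \<in> universe (N a) ()) \<in> universe (N a) ()" by (rule someI_ex)
  then show ?thesis
    using assms(1) by (auto simp: assignment_def fibre_env_def valid_def lies_over_def)
qed

lemma fibre_pred_cong:
  assumes "\<And>k. k \<in> insert w (fv_idx \<gamma>) \<Longrightarrow> e k = e' k"
  shows "fibre_pred w \<gamma> e \<longleftrightarrow> fibre_pred w \<gamma> e'"
proof -
  have "sat (N a) (fibre_env a e) \<gamma> \<longleftrightarrow> sat (N a) (fibre_env a e') \<gamma>" for a
    by (rule sat_cong) (use assms in \<open>auto simp: fibre_env_def lies_over_def fv_idx_iff\<close>)
  then show ?thesis
    using assms by (simp add: fibre_pred_def lies_over_def)
qed

lemma fibre_pred_upd_None: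
  "k \<in> insert w (fv_idx \<gamma>) \<Longrightarrow> \<not> fibre_pred w \<gamma> (e(k := (a, None)))"
  by (auto simp: fibre_pred_def lies_over_def)

text \<open>A relevant position holding a point over \<open>a\<close> forces the common fibre to be
  that of \<open>a\<close>, even when the anchor is another position.\<close>

lemma fibre_pred_upd_Some:
  assumes k: "k \<in> insert w (fv_idx \<gamma>)"
  shows "fibre_pred w \<gamma> (e(k := (a, Some b))) \<longleftrightarrow>
    (\<forall>j\<in>insert w (fv_idx \<gamma>) - {k}. lies_over e a j) \<and> sat (N a) ((fibre_env a e)(((), k) := b)) \<gamma>"
proof -
  let ?e = "e(k := (a, Some b))"
  have env: "fibre_env a ?e = (fibre_env a e)(((), k) := b)"
    by (auto simp: fun_eq_iff fibre_env_def lies_over_def)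
  have over: "(\<forall>j\<in>insert w (fv_idx \<gamma>). lies_over ?e (fst (?e w)) j) \<longleftrightarrow>
      fst (?e w) = a \<and> (\<forall>j\<in>insert w (fv_idx \<gamma>) - {k}. lies_over e a j)" (is "?l \<longleftrightarrow> ?r")
  proof
    assume l: ?l
    then have "lies_over ?e (fst (?e w)) k" using k by blast
    then have "fst (?e w) = a" by (simp add: lies_over_def)
    then show ?r using l by (auto simp: lies_over_def)
  next
    assume ?r
    then show ?l by (auto simp: lies_over_def)
  qed
  have w: "fst (?e w) = a" if "\<forall>j\<in>insert w (fv_idx \<gamma>) - {k}. lies_over e a j"
    using that by (cases "w = k") (auto simp: lies_over_def)
  show ?thesis
    unfolding fibre_pred_def over using w env by auto
qed

section \<open>Dependence on finitely many predicates\<close>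

definition agree ::
  "(unit, 'f, 'r) form set \<Rightarrow> (nat \<times> (unit, 'g, 'q) form) set \<Rightarrow> ('a, 'b) env \<Rightarrow> ('a, 'b) env \<Rightarrow> bool"
where
  "agree D G e e' \<longleftrightarrow> (\<forall>\<delta>\<in>D. index_pred \<delta> e \<longleftrightarrow> index_pred \<delta> e') \<and>
     (\<forall>(w, \<gamma>)\<in>G. fibre_pred w \<gamma> e \<longleftrightarrow> fibre_pred w \<gamma> e')"

text \<open>As \<open>D\<close> and \<open>G\<close> are finite, this amounts to being, on valid
  codes, a Boolean combination of their predicates, without having to exhibit one.\<close>

definition determined :: "(('a, 'b) env \<Rightarrow> bool) \<Rightarrow> bool" where
  "determined P \<longleftrightarrow> (\<exists>D G. finite D \<and> finite G \<and> (\<forall>\<delta>\<in>D. wf_form LM \<delta>) \<and> (\<forall>(w, \<gamma>)\<in>G. wf_form LN \<gamma>) \<and>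
     (\<forall>e e'. valid e \<longrightarrow> valid e' \<longrightarrow> agree D G e e' \<longrightarrow> P e = P e'))"

lemma determinedE:
  assumes "determined P"
  obtains D G where "finite D" "finite G" "\<And>\<delta>. \<delta> \<in> D \<Longrightarrow> wf_form LM \<delta>"
    "\<And>w \<gamma>. (w, \<gamma>) \<in> G \<Longrightarrow> wf_form LN \<gamma>"
    "\<And>e e'. valid e \<Longrightarrow> valid e' \<Longrightarrow> agree D G e e' \<Longrightarrow> P e = P e'"
proof -
  obtain D G where "finite D" "finite G" "\<forall>\<delta>\<in>D. wf_form LM \<delta>" "\<forall>(w, \<gamma>)\<in>G. wf_form LN \<gamma>"
    "\<forall>e e'. valid e \<longrightarrow> valid e' \<longrightarrow> agree D G e e' \<longrightarrow> P e = P e'"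
    using assms unfolding determined_def by (elim exE conjE)
  then show ?thesis using that[of D G] by blast
qed

text \<open>One direction suffices in \<open>imp\<close>, because agreement is symmetric. Closure
  under connectives and quantifiers is then proved by naming a finite family
  \<open>\<C>\<close>.\<close>

lemma determined_trans:
  assumes fin: "finite \<C>" and det: "\<And>C. C \<in> \<C> \<Longrightarrow> determined C"
    and imp: "\<And>e e'. valid e \<Longrightarrow> valid e' \<Longrightarrow> (\<And>C. C \<in> \<C> \<Longrightarrow> C e = C e') \<Longrightarrow> P e \<Longrightarrow> P e'"
  shows "determined P"
proof -
  have "\<forall>C\<in>\<C>. \<exists>DG. finite (fst DG) \<and> finite (snd DG) \<and> (\<forall>\<delta>\<in>fst DG. wf_form LM \<delta>) \<and>
     (\<forall>(w, \<gamma>)\<in>snd DG. wf_form LN \<gamma>) \<and>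
     (\<forall>e e'. valid e \<longrightarrow> valid e' \<longrightarrow> agree (fst DG) (snd DG) e e' \<longrightarrow> C e = C e')"
    using det unfolding determined_def by simp
  then obtain DG where DG: "\<forall>C\<in>\<C>. finite (fst (DG C)) \<and> finite (snd (DG C)) \<and>
     (\<forall>\<delta>\<in>fst (DG C). wf_form LM \<delta>) \<and> (\<forall>(w, \<gamma>)\<in>snd (DG C). wf_form LN \<gamma>) \<and>
     (\<forall>e e'. valid e \<longrightarrow> valid e' \<longrightarrow> agree (fst (DG C)) (snd (DG C)) e e' \<longrightarrow> C e = C e')"
    by (rule bchoice[THEN exE])
  define D where "D = (\<Union>C\<in>\<C>. fst (DG C))"
  define G where "G = (\<Union>C\<in>\<C>. snd (DG C))"
  have "agree (fst (DG C)) (snd (DG C)) e e'" if "agree D G e e'" "C \<in> \<C>" for C e e'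
    using that unfolding agree_def D_def G_def by blast
  then have C: "C e = C e'" if "agree D G e e'" "valid e" "valid e'" "C \<in> \<C>" for C e e'
    using that DG by blast
  have sym: "agree D G e' e" if "agree D G e e'" for e e'
    using that unfolding agree_def by blast
  have "P e = P e'" if "agree D G e e'" "valid e" "valid e'" for e e'
    using imp[of e e'] imp[of e' e] C[OF that] C[OF sym[OF that(1)] that(3) that(2)] that(2,3) by blast
  moreover have "finite D" "finite G" "\<forall>\<delta>\<in>D. wf_form LM \<delta>" "\<forall>(w, \<gamma>)\<in>G. wf_form LN \<gamma>"
    using DG fin unfolding D_def G_def by blast+
  ultimately show ?thesis unfolding determined_def by blast
qed

lemma determined_index_pred: "wf_form LM \<delta> \<Longrightarrow> determined (index_pred \<delta>)"
  unfolding determined_def agree_def by (intro exI[of _ "{\<delta>}"] exI[of _ "{}"]) simp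

lemma determined_fibre_pred: "wf_form LN \<gamma> \<Longrightarrow> determined (fibre_pred w \<gamma>)"
  unfolding determined_def agree_def by (intro exI[of _ "{(w, \<gamma>)}"] exI[of _ "{}"]) simp

lemma determined_const: "determined (\<lambda>_. b)"
  by (rule determined_trans[of "{}"]) auto

lemma determined_not: "determined P \<Longrightarrow> determined (\<lambda>e. \<not> P e)"
  by (rule determined_trans[of "{P}"]) auto

lemma determined_conj: "determined P \<Longrightarrow> determined Q \<Longrightarrow> determined (\<lambda>e. P e \<and> Q e)"
  by (rule determined_trans[of "{P, Q}"]) auto

lemma determined_disj: "determined P \<Longrightarrow> determined Q \<Longrightarrow> determined (\<lambda>e. P e \<or> Q e)"
  by (rule determined_trans[of "{P, Q}"]) auto

text \<open>A bare index at \<open>k\<close> falsifies the fibre predicates that involve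
  \<open>k\<close> and leaves the others unchanged. So only the type of \<open>a\<close> over
  \<open>D\<close> matters, and whether a given type is realised is a formula of
  \<open>M\<close>.\<close>

lemma determined_ex_index:
  assumes "determined P"
  shows "determined (\<lambda>e. \<exists>a\<in>universe M (). P (e(k := (a, None))))"
proof -
  from assms obtain D G where fin: "finite D" "finite G" and wf: "\<And>\<delta>. \<delta> \<in> D \<Longrightarrow> wf_form LM \<delta>"
    "\<And>w \<gamma>. (w, \<gamma>) \<in> G \<Longrightarrow> wf_form LN \<gamma>"
    and P: "\<And>e e'. valid e \<Longrightarrow> valid e' \<Longrightarrow> agree D G e e' \<Longrightarrow> P e = P e'"
    by (rule determinedE) blast
  obtain ds where ds: "set ds = D" using finite_list[OF fin(1)] by blast
  define I where "I = (\<lambda>T. index_pred (Exi ((), k) (type_form ((), k) ds T)))"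
  show ?thesis
  proof (rule determined_trans[of "I ` Pow D \<union> (\<lambda>(w, \<gamma>). fibre_pred w \<gamma>) ` G"])
    show "finite (I ` Pow D \<union> (\<lambda>(w, \<gamma>). fibre_pred w \<gamma>) ` G)" using fin by simp
    show "determined C" if "C \<in> I ` Pow D \<union> (\<lambda>(w, \<gamma>). fibre_pred w \<gamma>) ` G" for C
      using that wf by (auto simp: I_def ds wf_type_form intro!: determined_index_pred determined_fibre_pred)
  next
    fix e e' assume valid: "valid e" "valid e'"
      and C: "\<And>C. C \<in> I ` Pow D \<union> (\<lambda>(w, \<gamma>). fibre_pred w \<gamma>) ` G \<Longrightarrow> C e = C e'"
      and "\<exists>a\<in>universe M (). P (e(k := (a, None)))"
    then obtain a where a: "a \<in> universe M ()" "P (e(k := (a, None)))" by blast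
    define T where "T = {\<delta> \<in> D. sat M ((index_env e)(((), k) := a)) \<delta>}"
    have "I T e" using a(1) by (auto simp: I_def index_pred_def sat_type_form T_def ds)
    then have "I T e'" using C[of "I T"] by (auto simp: T_def)
    then obtain a' where a': "a' \<in> universe M ()"
      "\<And>\<delta>. \<delta> \<in> D \<Longrightarrow> sat M ((index_env e')(((), k) := a')) \<delta> \<longleftrightarrow> \<delta> \<in> T"
      by (auto simp: I_def index_pred_def sat_type_form ds)
    have "fibre_pred w \<gamma> (e(k := (a, None))) \<longleftrightarrow> fibre_pred w \<gamma> (e'(k := (a', None)))" if "(w, \<gamma>) \<in> G" for w \<gamma>
    proof (cases "k \<in> insert w (fv_idx \<gamma>)")
      case True
      then show ?thesis using fibre_pred_upd_None by blast
    next
      case False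
      then have "fibre_pred w \<gamma> (e(k := v)) \<longleftrightarrow> fibre_pred w \<gamma> e" for e v
        by (intro fibre_pred_cong) auto
      then show ?thesis using C[of "fibre_pred w \<gamma>"] that by auto
    qed
    then have "agree D G (e(k := (a, None))) (e'(k := (a', None)))"
      using a'(2) by (auto simp: agree_def index_pred_def index_env_upd T_def)
    then have "P (e'(k := (a', None)))"
      using P a valid_upd_None valid a'(1) by blast
    then show "\<exists>a\<in>universe M (). P (e'(k := (a, None)))" using a'(1) by blast
  qed
qed

lemma index_form_of_sentence:
  assumes "is_sentence LN \<theta>"
  shows "\<exists>\<chi>. wf_form LM \<chi> \<and> (\<forall>\<epsilon>. assignment M \<epsilon> \<longrightarrow> (sat M \<epsilon> \<chi> \<longleftrightarrow> models (N (\<epsilon> ((), k))) \<theta>))"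
proof -
  obtain \<chi> where \<chi>: "\<chi> \<in> unary_forms LM" "{a \<in> universe M (). models (N a) \<theta>} = solutions M \<chi>"
    using definable[OF assms] by (auto simp: zero_definable_def)
  \<comment> \<open>\<open>\<pi>\<close> exchanges the positions 0 and \<open>k\<close>. Merely
    sending 0 to \<open>k\<close> would in general not be injective, as \<open>sat_rename\<close>
    requires.\<close>
  define \<pi> where "\<pi> = (\<lambda>x :: unit var. if snd x = 0 then ((), k) else if snd x = k then ((), 0) else x)"
  have \<pi>: "inj \<pi>" by (auto simp: inj_def \<pi>_def split: if_splits)
  have "sat M \<epsilon> (rename \<pi> \<chi>) \<longleftrightarrow> models (N (\<epsilon> ((), k))) \<theta>" if \<epsilon>: "assignment M \<epsilon>" for \<epsilon>
  proof -
    have "sat M \<epsilon> (rename \<pi> \<chi>) \<longleftrightarrow> sat M (\<epsilon> \<circ> \<pi>) \<chi>"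
      using \<pi> by (rule sat_rename) simp
    also have "\<dots> \<longleftrightarrow> sat M (\<lambda>_. \<epsilon> ((), k)) \<chi>"
      by (rule sat_cong) (use \<chi>(1) in \<open>auto simp: unary_forms_def \<pi>_def\<close>)
    also have "\<dots> \<longleftrightarrow> \<epsilon> ((), k) \<in> solutions M \<chi>"
      using \<epsilon> by (simp add: solutions_def assignment_def)
    also have "\<dots> \<longleftrightarrow> models (N (\<epsilon> ((), k))) \<theta>"
      using \<epsilon> by (simp add: \<chi>(2)[symmetric] assignment_def)
    finally show ?thesis .
  qed
  moreover have "wf_form LM (rename \<pi> \<chi>)" using \<chi>(1) by (auto simp: unary_forms_def intro: wf_rename)
  ultimately show ?thesis by blast
qed

text \<open>
  A new point \<open>(a, b)\<close> either lies in the fibre of an old one, where \<open>b\<close> is described by a fibre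
  predicate, or in a new fibre.  In the latter case the existence of \<open>b\<close> is a sentence of the
  fibre, which the definability assumption turns into a condition on \<open>a\<close>.
\<close>

lemma determined_ex_point:
  assumes "determined P"
  shows "determined (\<lambda>e. \<exists>a\<in>universe M (). \<exists>b\<in>universe (N a) (). P (e(k := (a, Some b))))"
proof -
  from assms obtain D G where fin: "finite D" "finite G" and wf: "\<And>\<delta>. \<delta> \<in> D \<Longrightarrow> wf_form LM \<delta>"
    "\<And>w \<gamma>. (w, \<gamma>) \<in> G \<Longrightarrow> wf_form LN \<gamma>"
    and P: "\<And>e e'. valid e \<Longrightarrow> valid e' \<Longrightarrow> agree D G e e' \<Longrightarrow> P e = P e'"
    by (rule determinedE) blast
  obtain ds where ds: "set ds = D" using finite_list[OF fin(1)] by blast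
  \<comment> \<open>\<open>K\<close> collects the old positions that matter. The new point will be
    classified by the set \<open>J\<close> of those in its fibre, by its index type over
    \<open>D\<close> and by its fibre type over \<open>H J\<close>.\<close>
  define K where "K = (\<Union>(w, \<gamma>)\<in>G. insert w (fv_idx \<gamma>)) - {k}"
  have finK: "finite K" using fin(2) by (auto simp: K_def finite_fv_idx)
  \<comment> \<open>If exactly the positions \<open>J\<close> of \<open>K\<close> lie in the fibre
    of the new point, every predicate of \<open>G\<close> that involves \<open>k\<close> and whose
    formula is not collected here is false.\<close>
  define H where "H = (\<lambda>J. {\<gamma>. \<exists>w. (w, \<gamma>) \<in> G \<and> k \<in> insert w (fv_idx \<gamma>) \<and> insert w (fv_idx \<gamma>) \<subseteq> insert k J})"
  have finH: "finite (H J)" for J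
    by (rule finite_subset[of _ "snd ` G"]) (use fin(2) in \<open>force simp: H_def\<close>)+
  then have "\<forall>J. \<exists>l. set l = H J" using finite_list by blast
  then obtain hl where hl: "\<And>J. set (hl J) = H J" by metis
  have "\<forall>J. \<exists>l. finite J \<longrightarrow> set l = J" using finite_list by blast
  then obtain jl :: "nat set \<Rightarrow> nat list" where jl: "\<And>J. finite J \<Longrightarrow> set (jl J) = J" by metis
  \<comment> \<open>The existence of a point with fibre type \<open>T\<close> over the positions in
    \<open>J\<close>. For empty \<open>J\<close> it is a sentence, and the definability assumption
    gives \<open>\<chi>\<close>.\<close>
  define \<psi> where "\<psi> = (\<lambda>J T. Exi ((), k) (type_form ((), k) (hl J) T))"
  have fv_\<psi>: "fv_idx (\<psi> J T) \<subseteq> J" for J T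
  proof
    fix x assume "x \<in> fv_idx (\<psi> J T)"
    then obtain \<gamma> where "\<gamma> \<in> H J" "x \<in> fv_idx \<gamma>" "x \<noteq> k"
      by (auto simp: fv_idx_iff \<psi>_def free_vars_type_form hl)
    then show "x \<in> J" unfolding H_def by blast
  qed
  have wf_\<psi>: "wf_form LN (\<psi> J T)" for J T
    using wf(2) by (auto simp: \<psi>_def wf_type_form hl H_def)
  have "\<forall>T. \<exists>\<chi>. wf_form LM \<chi> \<and>
      (\<forall>\<epsilon>. assignment M \<epsilon> \<longrightarrow> (sat M \<epsilon> \<chi> \<longleftrightarrow> models (N (\<epsilon> ((), k))) (\<psi> {} T)))"
  proof
    fix T
    have "free_vars (\<psi> {} T) = {}" using fv_\<psi>[of "{}" T] by (auto simp: fv_idx_def)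
    then show "\<exists>\<chi>. wf_form LM \<chi> \<and>
      (\<forall>\<epsilon>. assignment M \<epsilon> \<longrightarrow> (sat M \<epsilon> \<chi> \<longleftrightarrow> models (N (\<epsilon> ((), k))) (\<psi> {} T)))"
      using wf_\<psi> by (intro index_form_of_sentence) (simp add: is_sentence_def)
  qed
  then obtain \<chi> where wf_\<chi>: "\<And>T. wf_form LM (\<chi> T)"
    and \<chi>: "\<And>T \<epsilon>. assignment M \<epsilon> \<Longrightarrow> sat M \<epsilon> (\<chi> T) \<longleftrightarrow> models (N (\<epsilon> ((), k))) (\<psi> {} T)"
    by metis
  \<comment> \<open>The reflexive equation is there for its variable: with the anchor
    \<open>i\<close> it says that \<open>i\<close> and \<open>j\<close> hold points of one
    fibre.\<close>
  define S where "S = (\<lambda>(i, j). fibre_pred i (Eq (Var ((), j)) (Var ((), j))))"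
  \<comment> \<open>Quantifier and equation together substitute the index at \<open>j\<close> for
    the new one, so that the type of an old index can be read off.\<close>
  define I1 where "I1 = (\<lambda>(j, T). index_pred
    (Exi ((), k) (And (Eq (Var ((), k)) (Var ((), j))) (type_form ((), k) ds T))))"
  define B1 where "B1 = (\<lambda>(j, J, T). fibre_pred j (\<psi> J T))"
  \<comment> \<open>The inequations keep the new index away from the old points, so that its fibre
    is new.\<close>
  define I2 where "I2 = (\<lambda>(T, T2, J). index_pred
    (Exi ((), k) (And (type_form ((), k) ds T) (And (\<chi> T2)
      (conj_form ((), k) (map (\<lambda>j. Neg (Eq (Var ((), k)) (Var ((), j)))) (jl J)))))))"
  define \<C> where "\<C> = (\<lambda>(w, \<gamma>). fibre_pred w \<gamma>) ` G \<union> S ` (K \<times> K) \<union> I1 ` (K \<times> Pow D)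
    \<union> B1 ` (K \<times> Sigma (Pow K) (\<lambda>J. Pow (H J))) \<union> I2 ` (Pow D \<times> Pow (H {}) \<times> Pow K)"
  have S_iff: "S (i, j) e \<longleftrightarrow> lies_over e (fst (e i)) i \<and> lies_over e (fst (e i)) j" for i j e
    by (auto simp: S_def fibre_pred_def fv_idx_def)
  show ?thesis
  proof (rule determined_trans[of \<C>])
    show "finite \<C>" using fin finK finH by (auto simp: \<C>_def)
    show "determined C" if "C \<in> \<C>" for C
      using that wf wf_\<psi> wf_\<chi>
      by (auto simp: \<C>_def S_def I1_def B1_def I2_def ds wf_type_form wf_conj_form
          intro!: determined_index_pred determined_fibre_pred)
  next
    fix e e' assume valid: "valid e" "valid e'"
      and C: "\<And>C. C \<in> \<C> \<Longrightarrow> C e = C e'"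
      and "\<exists>a\<in>universe M (). \<exists>b\<in>universe (N a) (). P (e(k := (a, Some b)))"
    then obtain a b where a: "a \<in> universe M ()" and b: "b \<in> universe (N a) ()"
      and Pab: "P (e(k := (a, Some b)))" by blast
    define J where "J = {j \<in> K. lies_over e a j}"
    define T where "T = {\<delta> \<in> D. sat M ((index_env e)(((), k) := a)) \<delta>}"
    define T2 where "T2 = {\<gamma> \<in> H J. sat (N a) ((fibre_env a e)(((), k) := b)) \<gamma>}"
    have S: "S (i, j) e \<longleftrightarrow> S (i, j) e'" if "i \<in> K" "j \<in> K" for i j
      using C[of "S (i, j)"] that by (auto simp: \<C>_def)
    have over: "lies_over e (fst (e j)) j \<longleftrightarrow> lies_over e' (fst (e' j)) j" if "j \<in> K" for j
      using S[OF that that] S_iff by blast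
    have "\<exists>a'\<in>universe M (). \<exists>b'\<in>universe (N a') (). {j \<in> K. lies_over e' a' j} = J \<and>
      (\<forall>\<delta>\<in>D. sat M ((index_env e')(((), k) := a')) \<delta> \<longleftrightarrow> \<delta> \<in> T) \<and>
      (\<forall>\<gamma>\<in>H J. sat (N a') ((fibre_env a' e')(((), k) := b')) \<gamma> \<longleftrightarrow> \<gamma> \<in> T2)"
    proof (cases "J = {}")
      case False
      then obtain i where i: "i \<in> K" "lies_over e a i" by (auto simp: J_def)
      then have ea: "fst (e i) = a" by (simp add: lies_over_def)
      \<comment> \<open>The new point shares the fibre of the old point at \<open>i\<close>, so its
        counterpart must share the fibre of the point at \<open>i\<close> in
        \<open>e'\<close>.\<close>
      define a' where "a' = fst (e' i)"
      have "lies_over e' a' i" using over[OF i(1)] i(2) ea by (simp add: a'_def)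
      then have J': "lies_over e' a' j \<longleftrightarrow> lies_over e a j" if "j \<in> K" for j
        using S[OF i(1) that] i(2) ea unfolding S_iff by (auto simp: a'_def)
      have "i \<noteq> k" using i(1) by (simp add: K_def)
      then have I1_iff: "I1 (i, T) u \<longleftrightarrow> (\<exists>c\<in>universe M (). c = fst (u i) \<and>
          (\<forall>\<delta>\<in>D. sat M ((index_env u)(((), k) := c)) \<delta> \<longleftrightarrow> \<delta> \<in> T))" for u
        by (auto simp: I1_def index_pred_def sat_type_form ds index_env_def)
      have "I1 (i, T) e" unfolding I1_iff using a ea by (auto simp: T_def)
      moreover have "I1 (i, T) \<in> \<C>" using i(1) by (auto simp: \<C>_def T_def)
      ultimately have "I1 (i, T) e'" using C by blast
      then have 1: "\<forall>\<delta>\<in>D. sat M ((index_env e')(((), k) := a')) \<delta> \<longleftrightarrow> \<delta> \<in> T"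
        by (auto simp: I1_iff a'_def)
      have "B1 (i, J, T2) e"
        using i ea b fv_\<psi>[of J T2]
        by (auto simp: B1_def fibre_pred_def J_def)
          (auto simp: \<psi>_def sat_type_form hl T2_def J_def)
      moreover have "B1 (i, J, T2) \<in> \<C>" using i(1) by (auto simp: \<C>_def T2_def J_def)
      ultimately have "B1 (i, J, T2) e'" using C by blast
      then obtain b' where "b' \<in> universe (N a') ()"
        "\<forall>\<gamma>\<in>H J. sat (N a') ((fibre_env a' e')(((), k) := b')) \<gamma> \<longleftrightarrow> \<gamma> \<in> T2"
        by (auto simp: B1_def fibre_pred_def \<psi>_def sat_type_form hl a'_def)
      moreover have "{j \<in> K. lies_over e' a' j} = J" using J' by (auto simp: J_def)
      ultimately show ?thesis using 1 validD[OF valid(2), of i] unfolding a'_def by blast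
    next
      case True
      \<comment> \<open>Only positions holding points have to be avoided. The new index may well
        equal a bare index, since no fibre predicate sees the latter as a point.\<close>
      define J0 where "J0 = {j \<in> K. lies_over e (fst (e j)) j}"
      have J0: "J0 \<subseteq> K" "finite J0" using finK by (auto simp: J0_def)
      have kJ0: "k \<notin> J0" using J0(1) by (auto simp: K_def)
      have I2_iff: "I2 (T, T2, J0) u \<longleftrightarrow> (\<exists>c\<in>universe M ().
          (\<forall>\<delta>\<in>D. sat M ((index_env u)(((), k) := c)) \<delta> \<longleftrightarrow> \<delta> \<in> T) \<and>
          models (N c) (\<psi> {} T2) \<and> (\<forall>j\<in>J0. c \<noteq> fst (u j)))" if "valid u" for u
      proof -
        have "sat M ((index_env u)(((), k) := c)) (\<chi> T2) \<longleftrightarrow> models (N c) (\<psi> {} T2)"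
          if "c \<in> universe M ()" for c
          using \<chi>[OF assignment_upd[OF assignment_index_env[OF \<open>valid u\<close>]]] that by simp
        moreover have "(\<forall>j\<in>J0. c \<noteq> ((index_env u)(((), k) := c)) ((), j)) \<longleftrightarrow> (\<forall>j\<in>J0. c \<noteq> fst (u j))" for c
          using kJ0 by (auto simp: index_env_def)
        ultimately show ?thesis
          by (simp add: I2_def index_pred_def sat_type_form ds sat_conj_form jl J0(2) cong: bex_cong)
      qed
      have models_iff: "models (N c) (\<psi> {} T2) \<longleftrightarrow> (\<exists>d\<in>universe (N c) ().
          \<forall>\<gamma>\<in>H {}. sat (N c) ((fibre_env c u)(((), k) := d)) \<gamma> \<longleftrightarrow> \<gamma> \<in> T2)"
        if "c \<in> universe M ()" "valid u" for c u
      proof -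
        have "is_sentence LN (\<psi> {} T2)"
          using wf_\<psi> fv_\<psi>[of "{}" T2] by (auto simp: is_sentence_def fv_idx_def)
        from models_iff_sat[OF this assignment_fibre_env[OF that(2,1)]]
        show ?thesis by (simp add: \<psi>_def sat_type_form hl)
      qed
      have "a \<noteq> fst (e j)" if "j \<in> J0" for j
        using that True by (auto simp: J_def J0_def lies_over_def)
      moreover have "models (N a) (\<psi> {} T2)"
        unfolding models_iff[OF a valid(1)] using b by (auto simp: T2_def True)
      ultimately have "I2 (T, T2, J0) e"
        unfolding I2_iff[OF valid(1)] using a by (auto simp: T_def)
      moreover have "I2 (T, T2, J0) \<in> \<C>" using J0(1) by (auto simp: \<C>_def T_def T2_def True)
      ultimately have "I2 (T, T2, J0) e'" using C by blast
      then obtain a' where a': "a' \<in> universe M ()"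
        "\<forall>\<delta>\<in>D. sat M ((index_env e')(((), k) := a')) \<delta> \<longleftrightarrow> \<delta> \<in> T"
        "models (N a') (\<psi> {} T2)" "\<forall>j\<in>J0. a' \<noteq> fst (e' j)"
        unfolding I2_iff[OF valid(2)] by blast
      have "\<not> lies_over e' a' j" if "j \<in> K" for j
        using over[OF that] a'(4) that by (auto simp: lies_over_def J0_def)
      then have "{j \<in> K. lies_over e' a' j} = J" using True by blast
      then show ?thesis
        using a' unfolding models_iff[OF a'(1) valid(2)] True by blast
    qed
    then obtain a' b' where a': "a' \<in> universe M ()" and b': "b' \<in> universe (N a') ()"
      and J': "{j \<in> K. lies_over e' a' j} = J"
      and T': "\<And>\<delta>. \<delta> \<in> D \<Longrightarrow> sat M ((index_env e')(((), k) := a')) \<delta> \<longleftrightarrow> \<delta> \<in> T"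
      and T2': "\<And>\<gamma>. \<gamma> \<in> H J \<Longrightarrow> sat (N a') ((fibre_env a' e')(((), k) := b')) \<gamma> \<longleftrightarrow> \<gamma> \<in> T2"
      by blast
    have "fibre_pred w \<gamma> (e(k := (a, Some b))) \<longleftrightarrow> fibre_pred w \<gamma> (e'(k := (a', Some b')))"
      if G: "(w, \<gamma>) \<in> G" for w \<gamma>
    proof (cases "k \<in> insert w (fv_idx \<gamma>)")
      case True
      have K: "insert w (fv_idx \<gamma>) - {k} \<subseteq> K" using G by (auto simp: K_def)
      have 1: "(\<forall>j\<in>insert w (fv_idx \<gamma>) - {k}. lies_over e a j) \<longleftrightarrow> insert w (fv_idx \<gamma>) \<subseteq> insert k J"
        using K unfolding J_def by blast
      have 2: "(\<forall>j\<in>insert w (fv_idx \<gamma>) - {k}. lies_over e' a' j) \<longleftrightarrow> insert w (fv_idx \<gamma>) \<subseteq> insert k J"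
        using K unfolding J'[symmetric] by blast
      show ?thesis
        unfolding fibre_pred_upd_Some[OF True] 1 2
      proof (rule conj_cong[OF refl])
        assume "insert w (fv_idx \<gamma>) \<subseteq> insert k J"
        then have "\<gamma> \<in> H J" unfolding H_def using G True by blast
        then show "sat (N a) ((fibre_env a e)(((), k) := b)) \<gamma> \<longleftrightarrow>
            sat (N a') ((fibre_env a' e')(((), k) := b')) \<gamma>"
          using T2' by (auto simp: T2_def)
      qed
    next
      case False
      then have "fibre_pred w \<gamma> (e(k := v)) \<longleftrightarrow> fibre_pred w \<gamma> e" for e v
        by (intro fibre_pred_cong) auto
      moreover have "fibre_pred w \<gamma> \<in> \<C>" using G by (auto simp: \<C>_def)
      ultimately show ?thesis using C by blast
    qed
    then have "agree D G (e(k := (a, Some b))) (e'(k := (a', Some b')))"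
      using T' by (auto simp: agree_def index_pred_def index_env_upd T_def)
    then have "P (e'(k := (a', Some b')))"
      using P Pab valid_upd_Some valid a b a' b' by blast
    then show "\<exists>a\<in>universe M (). \<exists>b\<in>universe (N a) (). P (e'(k := (a, Some b)))"
      using a' b' by blast
  qed
qed

end

section \<open>Formulas of the lexicographic sum\<close>

text \<open>The three sorts are told apart by residues modulo 3; the offsets start at 2 to keep
  positions 0 and 1 free.\<close>

definition pos :: "lex_sort var \<Rightarrow> nat" where
  "pos x = 3 * snd x + (case fst x of Main \<Rightarrow> 2 | Index \<Rightarrow> 3 | Extended \<Rightarrow> 4)"

lemma inj_pos: "inj pos"
proof (rule injI)
  fix x y assume "pos x = pos y"
  then show "x = y"
    by (cases x; cases y) (auto simp: pos_def split: lex_sort.splits, presburger+)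
qed

lemma pos_eq_iff [simp]: "pos x = pos y \<longleftrightarrow> x = y"
  using inj_pos by (simp add: inj_eq)

lemma pos_neq [simp]: "pos x \<noteq> 0" "pos x \<noteq> Suc 0"
  by (auto simp: pos_def split: lex_sort.splits)

text \<open>\<open>Undetermined\<close> shares its code with \<open>Ix a0\<close>. This is harmless,
  because the sort of a variable tells which of the two is meant.\<close>

fun code :: "'a \<Rightarrow> ('a, 'b) lex_elem \<Rightarrow> 'a \<times> 'b option" where
  "code a0 (Pt p) = (fst p, Some (snd p))"
| "code a0 (Ix a) = (a, None)"
| "code a0 Undetermined = (a0, None)"

lemma unit_list_eq_iff: "(xs :: unit list) = ys \<longleftrightarrow> length xs = length ys"
  by (auto intro: nth_equalityI)

context definable_fibres
begin

abbreviation "L \<equiv> lex_language LM LN"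

abbreviation "S \<equiv> lex_sum M N"

text \<open>
  \<open>represents a0 E e\<close>: \<open>e\<close> codes the assignment \<open>E\<close>.  Position 0 holds the arbitrary index \<open>a0\<close>
  used to code \<open>Undetermined\<close>, and position 1 is scratch space.
\<close>

definition represents ::
  "'a \<Rightarrow> (lex_sort var \<Rightarrow> ('a, 'b) lex_elem) \<Rightarrow> ('a, 'b) env \<Rightarrow> bool" where
  "represents a0 E e \<longleftrightarrow> assignment S E \<and> valid e \<and> e 0 = (a0, None) \<and> (\<forall>x. e (pos x) = code a0 (E x))"

lemma represents_validD: "represents a0 E e \<Longrightarrow> valid e"
  by (simp add: represents_def)

lemma representsD: "represents a0 E e \<Longrightarrow> e (pos x) = code a0 (E x)"
  by (simp only: represents_def)

lemma represents_in: "represents a0 E e \<Longrightarrow> E x \<in> universe S (fst x)"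
  by (simp only: represents_def assignment_def)

lemma universe_S:
  "universe S Main = Pt ` lex_points M N"
  "universe S Index = Ix ` universe M ()"
  "universe S Extended = insert Undetermined (Pt ` lex_points M N)"
  by (simp_all add: lex_sum_def)

lemma fint_S:
  "fint S Proj xs = Ix (fst (the_point (hd xs)))"
  "fint S Incl xs = hd xs"
  "fint S Undet xs = Undetermined"
  "fint S (IndexFun f) xs = Ix (fint M f (map the_index xs))"
  "fint S (FibreFun h) [Ix a] = Pt (a, fint (N a) h [])"
  "fint S (FibreFun h) (map Pt ps) = fibre_fun N h ps"
  by (auto simp: lex_sum_def comp_def split: list.splits)

lemma rint_S:
  "rint S (IndexRel r) xs \<longleftrightarrow> rint M r (map the_index xs)"
  "rint S (FibreRel q) xs \<longleftrightarrow> fibre_rel M N q (map the_point xs)"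
  by (simp_all add: lex_sum_def)

lemma represents_upd_1:
  assumes "represents a0 E e" "v \<in> universe S s"
  shows "represents a0 E (e(1 := code a0 v))"
proof -
  have "a0 \<in> universe M ()"
    using assms(1) validD[of e 0] by (simp add: represents_def)
  then show ?thesis
    using assms by (cases s)
      (auto simp: represents_def universe_S lex_points_def intro!: valid_upd_None valid_upd_Some)
qed

lemma represents_upd:
  assumes "represents a0 E e" "v \<in> universe S (fst x)"
  shows "represents a0 (E(x := v)) (e(pos x := code a0 v))"
proof -
  have "a0 \<in> universe M ()"
    using assms(1) validD[of e 0] by (simp add: represents_def)
  then have "valid (e(pos x := code a0 v))"
    using assms by (cases "fst x")
      (auto simp: represents_def universe_S lex_points_def intro!: valid_upd_None valid_upd_Some)
  then show ?thesis
    using assms by (simp add: represents_def assignment_upd)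
qed

lemma is_structure_S: "is_structure L S"
  unfolding is_structure_def
proof (intro conjI allI ballI impI)
  obtain a where a: "a \<in> universe M ()"
    using index_structure unfolding is_structure_def by blast
  then obtain b where "b \<in> universe (N a) ()"
    using fibre_structure unfolding is_structure_def by blast
  then have "(a, b) \<in> lex_points M N" using a by (simp add: lex_points_def)
  then show "universe S s \<noteq> {}" for s
    using a by (cases s) (auto simp: universe_S)
next
  fix h xs
  assume h: "h \<in> fsyms L" and xs: "list_all2 (\<lambda>x s. x \<in> universe S s) xs (fdom L h)"
  consider "h = Proj" | "h = Incl" | "h = Undet" | f where "h = IndexFun f" "f \<in> fsyms LM"
    | f where "h = FibreFun f" "f \<in> fsyms LN" "fdom LN f = []"
    | f where "h = FibreFun f" "f \<in> fsyms LN" "fdom LN f \<noteq> []"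
    using h by (auto simp: lex_language_def)
  then show "fint S h xs \<in> universe S (fcod L h)"
  proof cases
    case 1
    then obtain x where "xs = [x]" "x \<in> Pt ` lex_points M N"
      using xs by (auto simp: lex_language_def list_all2_Cons2 universe_S)
    then show ?thesis using 1 by (auto simp: fint_S universe_S lex_language_def lex_points_def)
  next
    case 2
    then obtain x where "xs = [x]" "x \<in> Pt ` lex_points M N"
      using xs by (auto simp: lex_language_def list_all2_Cons2 universe_S)
    then show ?thesis using 2 by (simp add: fint_S universe_S lex_language_def)
  next
    case 3
    then show ?thesis by (simp add: fint_S universe_S lex_language_def)
  next
    case 4
    have "list_all2 (\<lambda>x s. x \<in> Ix ` universe M ()) xs (fdom LM f)"
      using xs 4 by (simp add: lex_language_def list_all2_map2 universe_S)
    then have "list_all2 (\<lambda>x s. x \<in> universe M s) (map the_index xs) (fdom LM f)"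
      unfolding list_all2_map1 by (rule list_all2_mono) auto
    then have "fint M f (map the_index xs) \<in> universe M (fcod LM f)"
      using index_structure 4 unfolding is_structure_def by blast
    then show ?thesis using 4 by (simp add: fint_S universe_S lex_language_def)
  next
    case 5
    then obtain a where a: "xs = [Ix a]" "a \<in> universe M ()"
      using xs by (auto simp: lex_language_def list_all2_Cons2 universe_S)
    have "fint (N a) f [] \<in> universe (N a) (fcod LN f)"
      using fibre_structure[OF a(2)] 5 unfolding is_structure_def by auto
    then show ?thesis using 5 a by (simp add: fint_S universe_S lex_language_def lex_points_def)
  next
    case 6
    have len: "length xs = length (fdom LN f)" and "x \<in> Pt ` lex_points M N" if "x \<in> set xs" for x
      using xs 6 that
      by (auto simp: lex_language_def list_all2_conv_all_nth universe_S in_set_conv_nth)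
    then have pts: "\<forall>x\<in>set xs. \<exists>p\<in>lex_points M N. x = Pt p" by blast
    define ps where "ps = map the_point xs"
    have ps: "xs = map Pt ps" "set ps \<subseteq> lex_points M N"
      using pts by (auto simp: ps_def comp_def intro!: map_idI[symmetric])
    show ?thesis
    proof (cases "\<forall>p\<in>set ps. fst p = fst (hd ps)")
      case True
      have len: "length ps = length (fdom LN f)"
        using xs 6 by (auto simp: ps_def lex_language_def dest: list_all2_lengthD)
      then have "hd ps \<in> lex_points M N" using ps(2) 6 by (cases ps) auto
      then have a: "fst (hd ps) \<in> universe M ()" by (auto simp: lex_points_def)
      have "snd p \<in> universe (N (fst (hd ps))) ()" if "p \<in> set ps" for p
      proof -
        have "p \<in> lex_points M N" "fst p = fst (hd ps)" using ps(2) True that by blast+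
        then show ?thesis by (cases p) (auto simp: lex_points_def)
      qed
      then have "list_all2 (\<lambda>x s. x \<in> universe (N (fst (hd ps))) s) (map snd ps) (fdom LN f)"
        using len by (simp add: list_all2_conv_all_nth)
      then have "fint (N (fst (hd ps))) f (map snd ps) \<in> universe (N (fst (hd ps))) (fcod LN f)"
        using fibre_structure[OF a] 6 unfolding is_structure_def by blast
      then show ?thesis
        using 6 a True by (simp add: ps(1) fint_S universe_S lex_language_def lex_points_def fibre_fun_def)
    next
      case False
      then show ?thesis
        using 6 by (auto simp add: ps(1) fint_S universe_S lex_language_def fibre_fun_def)
    qed
  qed
qed

section \<open>Terms of the sum\<close>

text \<open>No symbol takes values in \<open>Main\<close>, which leaves only variables.\<close>

lemma wf_main_trm: "wf_trm L t \<Longrightarrow> trm_sort L t = Main \<Longrightarrow> \<exists>n. t = Var (Main, n)"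
  by (cases t) (auto simp: lex_language_def split: lex_fun.splits)

lemma main_trms:
  assumes "\<forall>t\<in>set ts. wf_trm L t" "map (trm_sort L) ts = map (\<lambda>_. Main) ss"
  shows "\<exists>ns. ts = map (\<lambda>n. Var (Main, n)) ns \<and> length ns = length ss"
proof -
  have "trm_sort L t = Main" if "t \<in> set ts" for t
  proof -
    have "trm_sort L t \<in> set (map (trm_sort L) ts)" using that by simp
    then show ?thesis unfolding assms(2) by auto
  qed
  then have "\<forall>t\<in>set ts. \<exists>n. t = Var (Main, n)" using assms(1) wf_main_trm by blast
  then obtain h where "\<forall>t\<in>set ts. t = Var (Main, h t)" by (rule bchoice[THEN exE])
  then have "ts = map (\<lambda>n. Var (Main, n)) (map h ts)" by (simp add: map_idI)
  moreover have "length (map h ts) = length ss" using arg_cong[OF assms(2), of length] by simp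
  ultimately show ?thesis by blast
qed

text \<open>\<open>Proj\<close> of a point variable becomes the variable of \<open>M\<close> at the
  same position, because \<open>index_env\<close> reads off the index of a point as well as a bare
  index. The symbols of \<open>M\<close> translate to themselves.\<close>

lemma ex_index_trm:
  assumes "wf_trm L t" "trm_sort L t = Index"
  shows "\<exists>u. wf_trm LM u \<and>
    (\<forall>a0 E e. represents a0 E e \<longrightarrow> trm_val S E t = Ix (trm_val M (index_env e) u))"
  using assms
proof (induction t)
  case (Var x)
  have "E x = Ix (trm_val M (index_env e) (Var ((), pos x)))" if "represents a0 E e" for a0 E e
    using represents_in[OF that, of x] representsD[OF that, of x] Var
    by (auto simp: universe_S index_env_def)
  then show ?case by (intro exI[of _ "Var ((), pos x)"]) auto
next
  case (Fn h ts)
  consider "h = Proj" | f where "h = IndexFun f" "f \<in> fsyms LM"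
    using Fn.prems by (auto simp: lex_language_def)
  then show ?case
  proof cases
    case 1
    have "map (trm_sort L) ts = map (\<lambda>_. Main) [()]" "\<forall>t\<in>set ts. wf_trm L t"
      using Fn.prems 1 by (auto simp: lex_language_def)
    then obtain n where n: "ts = [Var (Main, n)]"
      using main_trms by (fastforce simp: length_Suc_conv)
    have "trm_val S E (Fn h ts) = Ix (trm_val M (index_env e) (Var ((), pos (Main, n))))"
      if "represents a0 E e" for a0 E e
      using represents_in[OF that, of "(Main, n)"] representsD[OF that, of "(Main, n)"]
      by (auto simp: universe_S index_env_def 1 n fint_S)
    then show ?thesis by (intro exI[of _ "Var ((), pos (Main, n))"]) auto
  next
    case 2
    have sorts: "map (trm_sort L) ts = map (\<lambda>_. Index) (fdom LM f)"
      using Fn.prems 2 by (simp add: lex_language_def)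
    have "trm_sort L t = Index" if "t \<in> set ts" for t
    proof -
      have "trm_sort L t \<in> set (map (trm_sort L) ts)" using that by simp
      then show ?thesis unfolding sorts by auto
    qed
    then have "\<forall>t\<in>set ts. \<exists>u. wf_trm LM u \<and>
        (\<forall>a0 E e. represents a0 E e \<longrightarrow> trm_val S E t = Ix (trm_val M (index_env e) u))"
      using Fn by auto
    then obtain u where u: "\<forall>t\<in>set ts. wf_trm LM (u t) \<and>
        (\<forall>a0 E e. represents a0 E e \<longrightarrow> trm_val S E t = Ix (trm_val M (index_env e) (u t)))"
      by (rule bchoice[THEN exE])
    have "wf_trm LM (Fn f (map u ts))"
      using u 2 arg_cong[OF sorts, of length] by (auto simp: unit_list_eq_iff)
    moreover have "trm_val S E (Fn h ts) = Ix (trm_val M (index_env e) (Fn f (map u ts)))"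
      if "represents a0 E e" for a0 E e
    proof -
      have "map (the_index \<circ> trm_val S E) ts = map (trm_val M (index_env e) \<circ> u) ts"
        using u that by auto
      then show ?thesis by (simp add: 2 fint_S del: map_eq_conv)
    qed
    ultimately show ?thesis by blast
  qed
qed

text \<open>
  Position 1 holds a candidate for the value of \<open>t\<close>, so that an equation of sort \<open>Extended\<close> becomes
  the existence of a common value.
\<close>

lemma determined_extended_trm:
  assumes "wf_trm L t" "trm_sort L t = Extended"
  shows "\<exists>P. determined P \<and> (\<forall>a0 E e v. represents a0 E e \<longrightarrow> v \<in> universe S Extended \<longrightarrow>
    e 1 = code a0 v \<longrightarrow> (trm_val S E t = v \<longleftrightarrow> P e))"
proof -
  have some: "fibre_pred 1 (Eq (Var ((), 1)) (Var ((), 1))) e \<longleftrightarrow> snd (e 1) \<noteq> None" for e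
    by (auto simp: fibre_pred_def fv_idx_def lies_over_def)
  have det_some: "determined (fibre_pred 1 (Eq (Var ((), 1)) (Var ((), 1))))"
    by (rule determined_fibre_pred) simp
  have var: "\<exists>P. determined P \<and> (\<forall>a0 E e v. represents a0 E e \<longrightarrow> v \<in> universe S Extended \<longrightarrow>
    e 1 = code a0 v \<longrightarrow> (E x = v \<longleftrightarrow> P e))" if x: "fst x \<noteq> Index" for x
  proof (intro exI conjI allI impI)
    let ?p = "fibre_pred 1 (Eq (Var ((), 1)) (Var ((), pos x)))"
    let ?q = "fibre_pred (pos x) (Eq (Var ((), pos x)) (Var ((), pos x)))"
    \<comment> \<open>Either both values are points and equal, or both are
      \<open>Undetermined\<close>, which shows in positions 1 and \<open>pos x\<close> holding no
      point.\<close>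
    let ?P = "\<lambda>e. ?p e \<or> (\<not> fibre_pred 1 (Eq (Var ((), 1)) (Var ((), 1))) e \<and> \<not> ?q e)"
    show "determined ?P"
      by (intro determined_disj determined_conj determined_not det_some determined_fibre_pred) auto
    fix a0 E e v
    assume rep: "represents a0 E e" and v: "v \<in> universe S Extended" "e 1 = code a0 v"
    have q: "?q e \<longleftrightarrow> snd (e (pos x)) \<noteq> None"
      by (auto simp: fibre_pred_def fv_idx_def lies_over_def)
    have p: "?p e \<longleftrightarrow> snd (e 1) \<noteq> None \<and> e (pos x) = e 1"
      by (auto simp: fibre_pred_def fv_idx_def lies_over_def fibre_env_def prod_eq_iff)
    show "E x = v \<longleftrightarrow> ?P e"
      unfolding some p q using v represents_in[OF rep, of x] representsD[OF rep, of x] x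
      by (cases "fst x") (auto simp: universe_S)
  qed
  show ?thesis
  proof (cases t)
    case (Var x)
    then show ?thesis using var[of x] assms(2) by simp
  next
    case (Fn h ts)
    consider "h = Incl" | "h = Undet" | f where "h = FibreFun f" "f \<in> fsyms LN" "fdom LN f = []"
      | f where "h = FibreFun f" "f \<in> fsyms LN" "fdom LN f \<noteq> []"
      using assms Fn by (auto simp: lex_language_def)
    then show ?thesis
    proof cases
      case 1
      have "map (trm_sort L) ts = map (\<lambda>_. Main) [()]" "\<forall>t\<in>set ts. wf_trm L t"
        using assms Fn 1 by (auto simp: lex_language_def)
      then obtain n where "ts = [Var (Main, n)]"
        using main_trms by (fastforce simp: length_Suc_conv)
      then show ?thesis using var[of "(Main, n)"] by (simp add: Fn 1 fint_S)
    next
      case 2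
      have "Undetermined = v \<longleftrightarrow> \<not> fibre_pred 1 (Eq (Var ((), 1)) (Var ((), 1))) e"
        if "v \<in> universe S Extended" "e 1 = code a0 v" for a0 e v
        unfolding some using that by (auto simp: universe_S)
      then show ?thesis
        using determined_not[OF det_some] unfolding Fn 2 trm_val.simps fint_S by blast
    next
      case 3
      have "map (trm_sort L) ts = [Index]" "\<forall>t\<in>set ts. wf_trm L t"
        using assms Fn 3 by (auto simp: lex_language_def)
      then obtain t' where t': "ts = [t']" "wf_trm L t'" "trm_sort L t' = Index"
        by (auto simp: map_eq_Cons_conv)
      obtain u where u: "wf_trm LM u"
        "\<And>a0 E e. represents a0 E e \<Longrightarrow> trm_val S E t' = Ix (trm_val M (index_env e) u)"
        using ex_index_trm[OF t'(2,3)] by blast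
      \<comment> \<open>The candidate must lie over the argument \<open>u\<close> and be the value
        of the constant in that fibre.\<close>
      let ?P = "\<lambda>e. index_pred (Eq (Var ((), 1)) u) e \<and> fibre_pred 1 (Eq (Var ((), 1)) (Fn f [])) e"
      have "determined ?P"
        by (intro determined_conj determined_index_pred determined_fibre_pred) (use u(1) 3 in auto)
      moreover have "trm_val S E t = v \<longleftrightarrow> ?P e"
        if rep: "represents a0 E e" and v: "v \<in> universe S Extended" "e 1 = code a0 v" for a0 E e v
      proof -
        have "trm_val S E t = Pt (trm_val M (index_env e) u, fint (N (trm_val M (index_env e) u)) f [])"
          using u(2)[OF rep] by (simp add: Fn 3 t'(1) fint_S)
        moreover have "?P e \<longleftrightarrow> snd (e 1) \<noteq> None \<and> fst (e 1) = trm_val M (index_env e) u \<and>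
            the (snd (e 1)) = fint (N (trm_val M (index_env e) u)) f []"
          by (auto simp: index_pred_def fibre_pred_def fv_idx_def lies_over_def fibre_env_def index_env_def)
        ultimately show ?thesis using v by (auto simp: universe_S)
      qed
      ultimately show ?thesis by blast
    next
      case 4
      have "map (trm_sort L) ts = map (\<lambda>_. Main) (fdom LN f)" "\<forall>t\<in>set ts. wf_trm L t"
        using assms Fn 4 by (auto simp: lex_language_def)
      then obtain ns where ns: "ts = map (\<lambda>n. Var (Main, n)) ns" "length ns = length (fdom LN f)"
        using main_trms by blast
      then obtain n0 ns' where ns': "ns = n0 # ns'" using 4(3) by (cases ns) auto
      define T where "T = Fn f (map (\<lambda>n. Var ((), pos (Main, n))) ns)"
      have wfT: "wf_trm LN T" using ns(2) 4(2) by (simp add: T_def unit_list_eq_iff)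
      \<comment> \<open>\<open>Eq T T\<close> expresses only that the arguments lie in one fibre;
        otherwise the value is \<open>Undetermined\<close>. The anchor is the first argument, which
        exists because the arity is positive.\<close>
      let ?p = "fibre_pred 1 (Eq (Var ((), 1)) T)" and ?q = "fibre_pred (pos (Main, n0)) (Eq T T)"
      let ?P = "\<lambda>e. ?p e \<or> (\<not> fibre_pred 1 (Eq (Var ((), 1)) (Var ((), 1))) e \<and> \<not> ?q e)"
      have "determined ?P"
        by (intro determined_disj determined_conj determined_not det_some determined_fibre_pred)
          (use wfT in auto)
      moreover have "trm_val S E t = v \<longleftrightarrow> ?P e"
        if rep: "represents a0 E e" and v: "v \<in> universe S Extended" "e 1 = code a0 v" for a0 E e v
      proof -
        define p where "p = (\<lambda>n. the_point (E (Main, n)))"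
        have E: "E (Main, n) = Pt (p n)" for n
          using represents_in[OF rep, of "(Main, n)"] by (auto simp: universe_S p_def)
        have e: "e (pos (Main, n)) = (fst (p n), Some (snd (p n)))" for n
          using representsD[OF rep, of "(Main, n)"] by (simp add: E)
        have fv: "fv_idx (Eq T T) = (\<lambda>n. pos (Main, n)) ` set ns"
          "fv_idx (Eq (Var ((), 1)) T) = insert 1 ((\<lambda>n. pos (Main, n)) ` set ns)"
          by (auto simp: fv_idx_def T_def image_iff)
        have val: "trm_val S E t = fibre_fun N f (map p ns)"
          using fint_S(6)[of f "map p ns"] by (simp add: Fn 4 ns(1) E comp_def)
        have valT: "trm_val (N a) (fibre_env a e) T = fint (N a) f (map (snd \<circ> p) ns)"
          if "\<forall>n\<in>set ns. fst (p n) = a" for a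
        proof -
          have "map (\<lambda>n. fibre_env a e ((), pos (Main, n))) ns = map (snd \<circ> p) ns"
            using that by (auto simp: fibre_env_def lies_over_def e)
          then show ?thesis by (simp add: T_def comp_def del: map_eq_conv)
        qed
        have q: "?q e \<longleftrightarrow> (\<forall>n\<in>set ns. fst (p n) = fst (p n0))"
          using ns' by (auto simp: fibre_pred_def fv lies_over_def e)
        have p: "?p e \<longleftrightarrow> snd (e 1) \<noteq> None \<and> (\<forall>n\<in>set ns. fst (p n) = fst (e 1)) \<and>
            the (snd (e 1)) = fint (N (fst (e 1))) f (map (snd \<circ> p) ns)"
        proof -
          have "?p e \<longleftrightarrow> snd (e 1) \<noteq> None \<and> (\<forall>n\<in>set ns. fst (p n) = fst (e 1)) \<and>
            fibre_env (fst (e 1)) e ((), 1) = trm_val (N (fst (e 1))) (fibre_env (fst (e 1)) e) T"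
            unfolding fibre_pred_def fv by (auto simp: lies_over_def e)
          also have "\<dots> \<longleftrightarrow> snd (e 1) \<noteq> None \<and> (\<forall>n\<in>set ns. fst (p n) = fst (e 1)) \<and>
            the (snd (e 1)) = fint (N (fst (e 1))) f (map (snd \<circ> p) ns)"
            using valT[of "fst (e 1)"] by (auto simp: fibre_env_def lies_over_def)
          finally show ?thesis .
        qed
        show ?thesis
        proof (cases "\<forall>n\<in>set ns. fst (p n) = fst (p n0)")
          case True
          then have "trm_val S E t = Pt (fst (p n0), fint (N (fst (p n0))) f (map (snd \<circ> p) ns))"
            unfolding val fibre_fun_def by (simp add: ns' comp_def)
          moreover have "(\<forall>n\<in>set ns. fst (p n) = c) \<longleftrightarrow> c = fst (p n0)" for c
            using True ns' by auto
          moreover have "?q e" using q True by blast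
          ultimately show ?thesis
            unfolding p some using v by (auto simp: universe_S)
        next
          case False
          then have "trm_val S E t = Undetermined"
            unfolding val fibre_fun_def by (auto simp: ns')
          moreover have "\<not> (\<forall>n\<in>set ns. fst (p n) = fst (e 1))"
            using False ns' by auto
          ultimately show ?thesis
            unfolding p q some using v False by (auto simp: universe_S)
        qed
      qed
      ultimately show ?thesis by blast
    qed
  qed
qed

text \<open>Apart from points, the sort \<open>Extended\<close> contains only
  \<open>Undetermined\<close>, whose code carries the index held at position 0. This case is
  therefore a quantifier over indices restricted by an equation with position 0; the condition on
  \<open>k\<close> protects that position from being overwritten.\<close>

lemma determined_ex_extended:
  assumes "determined P" "k \<noteq> 0"
  shows "\<exists>Q. determined Q \<and> (\<forall>a0 (e :: ('a, 'b) env). a0 \<in> universe M () \<longrightarrow> e 0 = (a0, None) \<longrightarrow>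
    ((\<exists>v\<in>universe S Extended. P (e(k := code a0 v))) \<longleftrightarrow> Q e))"
proof (intro exI conjI allI impI)
  let ?R = "\<lambda>e. index_pred (Eq (Var ((), k)) (Var ((), 0))) e \<and> P e"
  let ?Q = "\<lambda>e. (\<exists>a\<in>universe M (). \<exists>b\<in>universe (N a) (). P (e(k := (a, Some b)))) \<or>
    (\<exists>a\<in>universe M (). ?R (e(k := (a, None))))"
  show "determined ?Q"
    by (intro determined_disj determined_ex_point determined_ex_index determined_conj
        determined_index_pred assms(1)) simp
  fix a0 and e :: "('a, 'b) env" assume a0: "a0 \<in> universe M ()" "e 0 = (a0, None)"
  have "?R (e(k := (a, None))) \<longleftrightarrow> a = a0 \<and> P (e(k := (a, None)))" for a
    using assms(2) a0 by (auto simp: index_pred_def index_env_def)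
  then have "(\<exists>a\<in>universe M (). ?R (e(k := (a, None)))) \<longleftrightarrow> P (e(k := (a0, None)))"
    using a0(1) by simp
  moreover have "(\<exists>v\<in>universe S Extended. P (e(k := code a0 v))) \<longleftrightarrow>
      (\<exists>a\<in>universe M (). \<exists>b\<in>universe (N a) (). P (e(k := (a, Some b)))) \<or> P (e(k := (a0, None)))"
    by (auto simp: universe_S lex_points_def)
  ultimately show "(\<exists>v\<in>universe S Extended. P (e(k := code a0 v))) \<longleftrightarrow> ?Q e"
    by simp
qed

lemma represents_0: "represents a0 E e \<Longrightarrow> a0 \<in> universe M () \<and> e 0 = (a0, None)"
  using validD[of e 0] by (simp add: represents_def)

lemma trm_val_extended:
  assumes "wf_trm L t" "trm_sort L t = Extended" "represents a0 E e"
  shows "trm_val S E t \<in> universe S Extended"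
proof -
  have "assignment S E" using assms(3) by (simp only: represents_def)
  from trm_val_in_universe[OF is_structure_S this assms(1)] show ?thesis by (simp only: assms(2))
qed

lemma determined_form:
  assumes "wf_form L \<phi>"
  shows "\<exists>P. determined P \<and> (\<forall>a0 E e. represents a0 E e \<longrightarrow> (sat S E \<phi> \<longleftrightarrow> P e))"
  using assms
proof (induction \<phi>)
  case (Eq t u)
  then have wf: "wf_trm L t" "wf_trm L u" and sort: "trm_sort L u = trm_sort L t" by auto
  show ?case
  proof (cases "trm_sort L t")
    case Main
    obtain m n where "t = Var (Main, m)" "u = Var (Main, n)"
      using wf_main_trm wf sort Main by metis
    moreover have "E (Main, m) = E (Main, n) \<longleftrightarrow>
        fibre_pred (pos (Main, m)) (Eq (Var ((), pos (Main, m))) (Var ((), pos (Main, n)))) e"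
      if rep: "represents a0 E e" for a0 E e
      using represents_in[OF rep, of "(Main, m)"] representsD[OF rep, of "(Main, m)"]
        represents_in[OF rep, of "(Main, n)"] representsD[OF rep, of "(Main, n)"]
      by (auto simp: universe_S fibre_pred_def fv_idx_def lies_over_def fibre_env_def)
    moreover have "determined (fibre_pred (pos (Main, m)) (Eq (Var ((), pos (Main, m))) (Var ((), pos (Main, n)))))"
      by (rule determined_fibre_pred) simp
    ultimately show ?thesis by auto
  next
    case Index
    obtain t' u' where "wf_trm LM t'" "wf_trm LM u'"
      "\<And>a0 E e. represents a0 E e \<Longrightarrow> trm_val S E t = Ix (trm_val M (index_env e) t')"
      "\<And>a0 E e. represents a0 E e \<Longrightarrow> trm_val S E u = Ix (trm_val M (index_env e) u')"
      using ex_index_trm wf sort Index by metis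
    then show ?thesis
      by (intro exI[of _ "index_pred (Eq t' u')"] conjI determined_index_pred) (auto simp: index_pred_def)
  next
    case Extended
    obtain P where P: "determined P" "\<And>a0 E e v. represents a0 E e \<Longrightarrow> v \<in> universe S Extended \<Longrightarrow>
        e 1 = code a0 v \<Longrightarrow> trm_val S E t = v \<longleftrightarrow> P e"
      using determined_extended_trm[OF wf(1) Extended] by blast
    obtain Q where Q: "determined Q" "\<And>a0 E e v. represents a0 E e \<Longrightarrow> v \<in> universe S Extended \<Longrightarrow>
        e 1 = code a0 v \<Longrightarrow> trm_val S E u = v \<longleftrightarrow> Q e"
      using determined_extended_trm[OF wf(2)] sort Extended by auto
    obtain R where R: "determined R" "\<And>a0 e. a0 \<in> universe M () \<Longrightarrow> e 0 = (a0, None) \<Longrightarrow>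
        (\<exists>v\<in>universe S Extended. P (e(1 := code a0 v)) \<and> Q (e(1 := code a0 v))) \<longleftrightarrow> R e"
      using determined_ex_extended[OF determined_conj[OF P(1) Q(1)], of 1] by auto
    have "sat S E (Eq t u) \<longleftrightarrow> R e" if rep: "represents a0 E e" for a0 E e
    proof -
      have "trm_val S E t = v \<and> trm_val S E u = v \<longleftrightarrow> P (e(1 := code a0 v)) \<and> Q (e(1 := code a0 v))"
        if v: "v \<in> universe S Extended" for v
        using P(2)[OF represents_upd_1[OF rep v] v] Q(2)[OF represents_upd_1[OF rep v] v] by simp
      then have "R e \<longleftrightarrow> (\<exists>v\<in>universe S Extended. trm_val S E t = v \<and> trm_val S E u = v)"
        using R(2) represents_0[OF rep] by blast
      then show ?thesis using trm_val_extended[OF wf(1) Extended rep] by auto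
    qed
    then show ?thesis using R(1) by blast
  qed
next
  case (Rel r ts)
  then have wf: "\<forall>t\<in>set ts. wf_trm L t" by simp
  consider r' where "r = IndexRel r'" "r' \<in> rsyms LM" | q where "r = FibreRel q" "q \<in> rsyms LN"
    using Rel by (auto simp: lex_language_def)
  then show ?case
  proof cases
    case 1
    have sorts: "map (trm_sort L) ts = map (\<lambda>_. Index) (rdom LM r')"
      using Rel 1 by (simp add: lex_language_def)
    have "trm_sort L t = Index" if "t \<in> set ts" for t
    proof -
      have "trm_sort L t \<in> set (map (trm_sort L) ts)" using that by simp
      then show ?thesis unfolding sorts by auto
    qed
    then have "\<forall>t\<in>set ts. \<exists>u. wf_trm LM u \<and>
        (\<forall>a0 E e. represents a0 E e \<longrightarrow> trm_val S E t = Ix (trm_val M (index_env e) u))"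
      using ex_index_trm wf by blast
    then obtain u where u: "\<forall>t\<in>set ts. wf_trm LM (u t) \<and>
        (\<forall>a0 E e. represents a0 E e \<longrightarrow> trm_val S E t = Ix (trm_val M (index_env e) (u t)))"
      by (rule bchoice[THEN exE])
    have "wf_form LM (Rel r' (map u ts))"
      using u 1 arg_cong[OF sorts, of length] by (auto simp: unit_list_eq_iff)
    moreover have "sat S E (Rel r ts) \<longleftrightarrow> index_pred (Rel r' (map u ts)) e"
      if "represents a0 E e" for a0 E e
    proof -
      have "map (the_index \<circ> trm_val S E) ts = map (trm_val M (index_env e) \<circ> u) ts"
        using u that by auto
      then show ?thesis by (simp add: 1 rint_S index_pred_def del: map_eq_conv)
    qed
    ultimately show ?thesis using determined_index_pred by blast
  next
    case 2
    have "map (trm_sort L) ts = map (\<lambda>_. Main) (rdom LN q)"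
      using Rel 2 by (simp add: lex_language_def)
    then obtain ns where ns: "ts = map (\<lambda>n. Var (Main, n)) ns" "length ns = length (rdom LN q)"
      using main_trms wf by blast
    show ?thesis
    proof (cases ns)
      case Nil
      \<comment> \<open>Without arguments there is no anchor to name a fibre, but neither does the
        truth value depend on the assignment.\<close>
      then have "sat S E (Rel r ts) \<longleftrightarrow> fibre_rel M N q []" for E by (simp add: 2 ns(1) rint_S)
      then show ?thesis using determined_const by blast
    next
      case (Cons n0 ns')
      let ?\<gamma> = "Rel q (map (\<lambda>n. Var ((), pos (Main, n))) ns)"
      have "wf_form LN ?\<gamma>" using ns(2) 2 by (auto simp: unit_list_eq_iff)
      moreover have "sat S E (Rel r ts) \<longleftrightarrow> fibre_pred (pos (Main, n0)) ?\<gamma> e"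
        if rep: "represents a0 E e" for a0 E e
      proof -
        define p where "p = (\<lambda>n. the_point (E (Main, n)))"
        have E: "E (Main, n) = Pt (p n)" for n
          using represents_in[OF rep, of "(Main, n)"] by (auto simp: universe_S p_def)
        have e: "e (pos (Main, n)) = (fst (p n), Some (snd (p n)))" for n
          using representsD[OF rep, of "(Main, n)"] by (simp add: E)
        have M: "fst (p n) \<in> universe M ()" for n
          using represents_in[OF rep, of "(Main, n)"] by (auto simp: universe_S E lex_points_def)
        have fv: "fv_idx ?\<gamma> = (\<lambda>n. pos (Main, n)) ` set ns"
          by (auto simp: fv_idx_def image_iff)
        let ?a = "fst (p n0)"
        have "sat S E (Rel r ts) \<longleftrightarrow> fibre_rel M N q (map p ns)"
          by (simp add: 2 ns(1) rint_S E comp_def)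
        also have "\<dots> \<longleftrightarrow> (\<forall>n\<in>set ns. fst (p n) = ?a) \<and> rint (N ?a) q (map (snd \<circ> p) ns)"
        proof
          assume "fibre_rel M N q (map p ns)"
          then obtain a bs where a: "map p ns = map (\<lambda>b. (a, b)) bs" "rint (N a) q bs"
            by (auto simp: fibre_rel_def)
          have 1: "\<forall>n\<in>set ns. fst (p n) = a"
          proof
            fix n assume "n \<in> set ns"
            then have "p n \<in> set (map p ns)" by simp
            then show "fst (p n) = a" unfolding a(1) by auto
          qed
          have "map snd (map p ns) = bs" unfolding a(1) by (simp add: comp_def)
          then show "(\<forall>n\<in>set ns. fst (p n) = ?a) \<and> rint (N ?a) q (map (snd \<circ> p) ns)"
            using 1 a(2) Cons by simp
        next
          assume *: "(\<forall>n\<in>set ns. fst (p n) = ?a) \<and> rint (N ?a) q (map (snd \<circ> p) ns)"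
          then have "map p ns = map (\<lambda>b. (?a, b)) (map (snd \<circ> p) ns)"
            by (auto simp: prod_eq_iff)
          then show "fibre_rel M N q (map p ns)" using * M unfolding fibre_rel_def by blast
        qed
        also have "\<dots> \<longleftrightarrow> fibre_pred (pos (Main, n0)) ?\<gamma> e"
        proof -
          have sat: "sat (N ?a) (fibre_env ?a e) ?\<gamma> \<longleftrightarrow> rint (N ?a) q (map (snd \<circ> p) ns)"
            if "\<forall>n\<in>set ns. fst (p n) = ?a"
          proof -
            have "map (\<lambda>n. fibre_env ?a e ((), pos (Main, n))) ns = map (snd \<circ> p) ns"
              using that by (auto simp: fibre_env_def lies_over_def e)
            then show ?thesis by (simp add: comp_def del: map_eq_conv)
          qed
          have "fst (e (pos (Main, n0))) = ?a" by (simp add: e)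
          moreover have "(\<forall>k\<in>insert (pos (Main, n0)) (fv_idx ?\<gamma>). lies_over e ?a k) \<longleftrightarrow>
              (\<forall>n\<in>set ns. fst (p n) = ?a)"
            unfolding fv by (auto simp: lies_over_def e)
          ultimately show ?thesis unfolding fibre_pred_def using sat by metis
        qed
        finally show ?thesis .
      qed
      ultimately show ?thesis using determined_fibre_pred by blast
    qed
  qed
next
  case (Neg \<phi>)
  then obtain P where "determined P" "\<And>a0 E e. represents a0 E e \<Longrightarrow> sat S E \<phi> \<longleftrightarrow> P e" by auto
  then show ?case by (intro exI[of _ "\<lambda>e. \<not> P e"] conjI determined_not) auto
next
  case (And \<phi> \<psi>)
  then obtain P Q where "determined P" "\<And>a0 E e. represents a0 E e \<Longrightarrow> sat S E \<phi> \<longleftrightarrow> P e"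
    "determined Q" "\<And>a0 E e. represents a0 E e \<Longrightarrow> sat S E \<psi> \<longleftrightarrow> Q e" by auto
  then show ?case by (intro exI[of _ "\<lambda>e. P e \<and> Q e"] conjI determined_conj) auto
next
  case (Exi x \<phi>)
  then obtain P where P: "determined P" "\<And>a0 E e. represents a0 E e \<Longrightarrow> sat S E \<phi> \<longleftrightarrow> P e" by auto
  have sat: "sat S E (Exi x \<phi>) \<longleftrightarrow> (\<exists>v\<in>universe S (fst x). P (e(pos x := code a0 v)))"
    if "represents a0 E e" for a0 E e
    using P(2)[OF represents_upd[OF that]] by (auto cong: bex_cong)
  show ?case
  proof (cases "fst x")
    case Main
    then show ?thesis
      using sat determined_ex_point[OF P(1), of "pos x"]
      by (intro exI[of _ "\<lambda>e. \<exists>a\<in>universe M (). \<exists>b\<in>universe (N a) (). P (e(pos x := (a, Some b)))"])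
        (auto simp: universe_S lex_points_def)
  next
    case Index
    then show ?thesis
      using sat determined_ex_index[OF P(1), of "pos x"]
      by (intro exI[of _ "\<lambda>e. \<exists>a\<in>universe M (). P (e(pos x := (a, None)))"]) (auto simp: universe_S)
  next
    case Extended
    obtain Q where Q: "determined Q" "\<And>a0 e. a0 \<in> universe M () \<Longrightarrow> e 0 = (a0, None) \<Longrightarrow>
        (\<exists>v\<in>universe S Extended. P (e(pos x := code a0 v))) \<longleftrightarrow> Q e"
      using determined_ex_extended[OF P(1), of "pos x"] by auto
    have "sat S E (Exi x \<phi>) \<longleftrightarrow> Q e" if "represents a0 E e" for a0 E e
      using sat[OF that] Q(2) represents_0[OF that] Extended by simp
    then show ?thesis using Q(1) by blast
  qed
qed

section \<open>Transfer of independent patterns from the sum to \<open>M\<close> and the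
  fibres\<close>

lemma index_pred_IP:
  assumes "independent (Collect valid) (Collect valid) (\<lambda>a b. index_pred \<delta> (override_on b a X)) n"
  shows "IP_at M \<delta> {x. snd x \<in> X} n"
proof (rule independent_map[OF assms, of index_env])
  fix a b :: "('a, 'b) env"
  have "index_env (override_on b a X) = override_on (index_env b) (index_env a) {x. snd x \<in> X}"
    by (auto simp: fun_eq_iff index_env_def override_on_def)
  then show "index_pred \<delta> (override_on b a X) \<longleftrightarrow>
      sat M (override_on (index_env b) (index_env a) {x. snd x \<in> X}) \<delta>"
    by (simp add: index_pred_def)
qed (auto simp: assignment_index_env)

text \<open>
  The trace on the full set forces all tuples involved into a common fibre \<open>c\<close>; one spare element
  \<open>n\<close>, put into every trace, does the same for the parameters.
\<close>

lemma fibre_pred_IP: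
  assumes ind: "independent (Collect valid) (Collect valid)
    (\<lambda>a b. fibre_pred w \<gamma> (override_on b a X)) (Suc (Suc n))"
  shows "\<exists>c\<in>universe M (). IP_at (N c) \<gamma> {x. snd x \<in> X} n"
proof -
  \<comment> \<open>Tuple number \<open>m\<close> is the spare one. This choice of \<open>m\<close>
    provides at least two tuples even for \<open>n = 0\<close>, which the proof of
    \<open>W \<inter> X \<noteq> {}\<close> needs.\<close>
  define m where "m = Suc n"
  define W where "W = insert w (fv_idx \<gamma>)"
  define R where "R = (\<lambda>a b. fibre_pred w \<gamma> (override_on b a X))"
  obtain a where a: "\<And>i. i < Suc m \<Longrightarrow> valid (a i)"
    and "\<forall>I\<subseteq>{..<Suc m}. \<exists>b. valid b \<and> (\<forall>i<Suc m. R (a i) b \<longleftrightarrow> i \<in> I)"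
    using ind unfolding independent_def m_def R_def by auto
  then obtain b where b: "\<And>I. I \<subseteq> {..<Suc m} \<Longrightarrow> valid (b I)"
    "\<And>I i. I \<subseteq> {..<Suc m} \<Longrightarrow> i < Suc m \<Longrightarrow> R (a i) (b I) \<longleftrightarrow> i \<in> I"
    by metis
  \<comment> \<open>If no relevant position belonged to \<open>X\<close>, the predicate could not
    tell two tuples apart; if all did, it could not tell two parameters apart.\<close>
  have "W \<inter> X \<noteq> {}"
  proof
    assume "W \<inter> X = {}"
    then have "R (a 0) (b {0}) \<longleftrightarrow> R (a 1) (b {0})"
      unfolding R_def by (intro fibre_pred_cong) (auto simp: W_def override_on_def)
    then show False using b(2)[of "{0}" 0] b(2)[of "{0}" 1] by (simp add: m_def)
  qed
  then obtain x where x: "x \<in> W" "x \<in> X" by blast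
  have "\<not> W \<subseteq> X"
  proof
    assume "W \<subseteq> X"
    then have "R (a 0) (b {0}) \<longleftrightarrow> R (a 0) (b {})"
      unfolding R_def by (intro fibre_pred_cong) (auto simp: W_def)
    then show False using b(2)[of "{0}" 0] b(2)[of "{}" 0] by simp
  qed
  then obtain y where y: "y \<in> W" "y \<notin> X" by blast
  have same: "lies_over (override_on (b I) (a i) X) (fst (override_on (b I) (a i) X w)) z"
    if "I \<subseteq> {..<Suc m}" "i \<in> I" "z \<in> W" for I i z
    using b(2)[OF that(1), of i] that unfolding R_def fibre_pred_def W_def by auto
  \<comment> \<open>The parameter for the full trace is related to every \<open>a i\<close>, so its
    index at \<open>y\<close> is common to all of them.\<close>
  define c where "c = fst (b {..<Suc m} y)"
  have a_over: "lies_over (a i) c z" if i: "i < Suc m" and z: "z \<in> W" "z \<in> X" for i z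
    using same[of "{..<Suc m}" i z] same[of "{..<Suc m}" i y] i z y
    by (auto simp: lies_over_def c_def)
  have b_over: "lies_over (b I) c z" if I: "I \<subseteq> {..<Suc m}" "m \<in> I" and z: "z \<in> W" "z \<notin> X" for I z
    using same[of I m z] same[of I m x] I z x a_over[of m x]
    by (auto simp: lies_over_def)
  have c: "c \<in> universe M ()" unfolding c_def by (intro validD b) simp
  have "IP_at (N c) \<gamma> {x. snd x \<in> X} m"
    unfolding independent_def
  proof (intro exI[of _ "\<lambda>i. fibre_env c (a i)"] conjI allI impI)
    show "fibre_env c (a i) \<in> Collect (assignment (N c))" if "i < m" for i
      using assignment_fibre_env[OF a c] that by simp
  next
    fix I assume I: "I \<subseteq> {..<m}"
    define I' where "I' = insert m I"
    have I': "I' \<subseteq> {..<Suc m}" "m \<in> I'" using I by (auto simp: I'_def)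
    have "sat (N c) (override_on (fibre_env c (b I')) (fibre_env c (a i)) {x. snd x \<in> X}) \<gamma> \<longleftrightarrow> i \<in> I"
      if i: "i < m" for i
    proof -
      let ?o = "override_on (b I') (a i) X"
      have over: "lies_over ?o c z" if z: "z \<in> W" for z
      proof (cases "z \<in> X")
        case True
        then show ?thesis using a_over[of i z] i z by (simp add: lies_over_def)
      next
        case False
        then show ?thesis using b_over[OF I' z] by (simp add: lies_over_def)
      qed
      then have "fst (?o w) = c" by (simp add: lies_over_def W_def)
      then have "R (a i) (b I') \<longleftrightarrow> sat (N c) (fibre_env c ?o) \<gamma>"
        using over unfolding R_def fibre_pred_def W_def by simp
      also have "fibre_env c ?o = override_on (fibre_env c (b I')) (fibre_env c (a i)) {x. snd x \<in> X}"
        by (auto simp: fun_eq_iff fibre_env_def lies_over_def override_on_def)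
      finally show ?thesis using b(2)[OF I'(1), of i] i by (auto simp: I'_def)
    qed
    moreover have "fibre_env c (b I') \<in> Collect (assignment (N c))"
      using assignment_fibre_env[OF b(1)[OF I'(1)] c] by simp
    ultimately show "\<exists>b\<in>Collect (assignment (N c)). \<forall>i<m.
        sat (N c) (override_on b (fibre_env c (a i)) {x. snd x \<in> X}) \<gamma> \<longleftrightarrow> i \<in> I"
      by blast
  qed
  then show ?thesis using c independent_mono[of _ _ _ m n] by (auto simp: m_def)
qed

lemma determined_not_independent:
  assumes det: "determined P" and M: "NIP LM M"
    and fib: "\<And>\<gamma> X. wf_form LN \<gamma> \<Longrightarrow> \<exists>n. \<forall>a\<in>universe M (). \<not> IP_at (N a) \<gamma> X n"
  shows "\<exists>n. \<not> independent (Collect valid) (Collect valid) (\<lambda>a b. P (override_on b a X)) n"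
proof (rule ccontr)
  assume "\<not> ?thesis"
  then have ind: "independent (Collect valid) (Collect valid) (\<lambda>a b. P (override_on b a X)) n" for n
    by (simp only: not_ex) simp
  from det obtain D G where fin: "finite D" "finite G" and wf: "\<And>\<delta>. \<delta> \<in> D \<Longrightarrow> wf_form LM \<delta>"
    "\<And>w \<gamma>. (w, \<gamma>) \<in> G \<Longrightarrow> wf_form LN \<gamma>"
    and P: "\<And>e e'. valid e \<Longrightarrow> valid e' \<Longrightarrow> agree D G e e' \<Longrightarrow> P e = P e'"
    by (rule determinedE) blast
  define \<R> where "\<R> = (\<lambda>Q a b. Q (override_on b a X)) ` (index_pred ` D \<union> (\<lambda>(w, \<gamma>). fibre_pred w \<gamma>) ` G)"
  have "\<exists>S\<in>\<R>. \<forall>n. independent (Collect valid) (Collect valid) S n"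
  proof (rule determined_independent[OF _ _ ind])
    show "finite \<R>" using fin by (simp add: \<R>_def)
    fix x x' y y'
    assume v: "x \<in> Collect valid" "x' \<in> Collect valid" "y \<in> Collect valid" "y' \<in> Collect valid"
      and S: "\<And>S. S \<in> \<R> \<Longrightarrow> S x y \<longleftrightarrow> S x' y'"
    have "Q (override_on y x X) \<longleftrightarrow> Q (override_on y' x' X)"
      if "Q \<in> index_pred ` D \<union> (\<lambda>(w, \<gamma>). fibre_pred w \<gamma>) ` G" for Q
      using S[of "\<lambda>a b. Q (override_on b a X)"] that unfolding \<R>_def by blast
    then have "agree D G (override_on y x X) (override_on y' x' X)"
      unfolding agree_def by blast
    then show "P (override_on y x X) \<longleftrightarrow> P (override_on y' x' X)"
      using P valid_override_on v by simp
  qed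
  then consider \<delta> where "\<delta> \<in> D" "\<And>n. independent (Collect valid) (Collect valid)
      (\<lambda>a b. index_pred \<delta> (override_on b a X)) n"
    | w \<gamma> where "(w, \<gamma>) \<in> G" "\<And>n. independent (Collect valid) (Collect valid)
      (\<lambda>a b. fibre_pred w \<gamma> (override_on b a X)) n"
    unfolding \<R>_def by auto
  then show False
  proof cases
    case 1
    then show False using index_pred_IP M wf(1) unfolding NIP_def has_IP_iff by blast
  next
    case 2
    then show False using fibre_pred_IP fib[OF wf(2)] by blast
  qed
qed

lemma lex_sum_NIP:
  assumes M: "NIP LM M"
    and fib: "\<And>\<gamma> X. wf_form LN \<gamma> \<Longrightarrow> \<exists>n. \<forall>a\<in>universe M (). \<not> IP_at (N a) \<gamma> X n"
  shows "NIP L S"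
  unfolding NIP_def
proof (intro allI impI)
  fix \<phi> X assume wf: "wf_form L \<phi>"
  obtain a0 where a0: "a0 \<in> universe M ()"
    using index_structure unfolding is_structure_def by blast
  obtain P where P: "determined P" "\<And>a0 E e. represents a0 E e \<Longrightarrow> sat S E \<phi> \<longleftrightarrow> P e"
    using determined_form[OF wf] by blast
  \<comment> \<open>A canonical code: positions outside the range of \<open>pos\<close>, among them
    0 and 1, hold the bare index \<open>a0\<close>. Hence it commutes with overriding, where
    \<open>X\<close> turns into its image under \<open>pos\<close>.\<close>
  define \<kappa> where "\<kappa> = (\<lambda>(E :: lex_sort var \<Rightarrow> ('a, 'b) lex_elem) m.
    if m \<in> range pos then code a0 (E (inv pos m)) else (a0, None))"
  have rep: "represents a0 E (\<kappa> E)" if E: "assignment S E" for E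
  proof -
    have "fst (code a0 (E x)) \<in> universe M () \<and>
        (\<forall>b. snd (code a0 (E x)) = Some b \<longrightarrow> b \<in> universe (N (fst (code a0 (E x)))) ())" for x
    proof -
      have "E x \<in> universe S (fst x)" using E by (simp only: assignment_def)
      then show ?thesis using a0 by (cases "fst x") (auto simp: universe_S lex_points_def)
    qed
    then have "valid (\<kappa> E)" using a0 by (auto simp: valid_def \<kappa>_def)
    moreover have "0 \<notin> range pos" using pos_neq(1) by (metis rangeE)
    ultimately show ?thesis using E by (auto simp: represents_def \<kappa>_def inv_f_f[OF inj_pos])
  qed
  obtain n where n: "\<not> independent (Collect valid) (Collect valid) (\<lambda>a b. P (override_on b a (pos ` X))) n"
    using determined_not_independent[OF P(1) M fib] by blast
  show "\<not> has_IP S \<phi> X"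
  proof
    assume "has_IP S \<phi> X"
    then have "IP_at S \<phi> X n" by (simp add: has_IP_iff)
    then have "independent (Collect valid) (Collect valid) (\<lambda>a b. P (override_on b a (pos ` X))) n"
    proof (rule independent_map[where f = \<kappa> and g = \<kappa>])
      fix a b assume "a \<in> Collect (assignment S)" "b \<in> Collect (assignment S)"
      then have "sat S (override_on b a X) \<phi> \<longleftrightarrow> P (\<kappa> (override_on b a X))"
        by (intro P(2)[OF rep] assignment_override_on) auto
      also have "\<kappa> (override_on b a X) = override_on (\<kappa> b) (\<kappa> a) (pos ` X)"
        by (auto simp: fun_eq_iff \<kappa>_def override_on_def inv_f_f[OF inj_pos] image_iff)
      finally show "sat S (override_on b a X) \<phi> \<longleftrightarrow> P (override_on (\<kappa> b) (\<kappa> a) (pos ` X))" .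
    qed (use rep represents_validD in auto)
    then show False using n by blast
  qed
qed

end

theorem corollary2p14:
  fixes LM :: "(unit, 'f, 'r) language"
    and LN :: "(unit, 'g, 'q) language"
    and M :: "(unit, 'f, 'r, 'a) struct"
    and N :: "'a \<Rightarrow> (unit, 'g, 'q, 'b) struct"
    and \<U> :: "(unit, 'f, 'r) form set \<Rightarrow> 'a filter"
  assumes "is_structure LM M"
    and "\<And>a. a \<in> universe M () \<Longrightarrow> is_structure LN (N a)"
    and "\<And>\<phi>. is_sentence LN \<phi> \<Longrightarrow> zero_definable LM M {a \<in> universe M (). models (N a) \<phi>}"
    and "NIP LM M"
    and "\<And>\<rho>. \<rho> \<in> complete_1_types LM M \<Longrightarrow>
           ultrafilter_on (universe M ()) (\<U> \<rho>) \<and>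
           (\<forall>\<phi>\<in>\<rho>. eventually (\<lambda>a. a \<in> solutions M \<phi>) (\<U> \<rho>))"
    and "\<And>\<rho>. \<rho> \<in> complete_1_types LM M \<Longrightarrow> NIP LN (ultraproduct (universe M ()) (\<U> \<rho>) N)"
  shows "NIP (lex_language LM LN) (lex_sum M N)"
proof -
  interpret definable_fibres LM LN M N
    using assms(1-3) by unfold_locales
  show ?thesis
    using assms(4) fibres_uniformly_NIP[OF assms(1-3,5,6)] by (rule lex_sum_NIP)
qed

end
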